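(* Let $\Gamma$ be a metrized graph and $p,q\in\Gamma$. Then the following quantities are all equal: (i) $A_{p,q,\Gamma}$; (ii) $\frac12\int_\Gamma j_x(p,q)\,\Delta_x\big(j_p(x,q)\,j_q(x,p)\big)$; (iii) $\frac12\int_\Gamma j_p(x,q)\,j_q(x,p)\,\Delta_x j_x(p,q)$; (iv) $-\int_\Gamma j_p(x,q)\,\frac{d}{dx}j_p(x,q)\,\frac{d}{dx}j_x(p,q)\,dx$; (v) $\int_\Gamma j_q(x,p)\,\frac{d}{dx}j_p(x,q)\,\frac{d}{dx}j_x(p,q)\,dx$; (vi) $-\frac{r(p,q)^2}{2}+\int_\Gamma r(p,x)\big(\frac{d}{dx}j_p(x,q)\big)^2dx$.
   Context: A metrized graph $\Gamma$ is a finite connected graph (multiple edges and self-loops allowed) in which each edge is identified with a closed real interval of positive length, with a finite non-empty vertex set $V(\Gamma)$ containing all points of valence $\ne2$; $dx$ is arclength and $d/dx$ is differentiation along edges. Regard $\Gamma$ as a resistive circuit with segment resistance equal to length. For $x,y,z\in\Gamma$, $j_z(x,y)$ is the potential at $x$ when unit current enters at $y$ and exits at $z$, with potential $0$ at $z$; $r(x,y)=j_x(y,y)$ is the effective resistance. Define $A_{p,q,\Gamma}=\int_\Gamma j_x(p,q)\big(\frac{d}{dx}j_p(x,q)\big)^2dx$. For $f$ continuous on $\Gamma$, $C^2$ off a finite vertex set with $f''\in L^1$, the Laplacian is the measure $\Delta_x f=-f''(x)dx-\sum_{p\in V(\Gamma)}\big[\sum_{\vec v\text{ at }p}d_{\vec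 v}f(p)\big]\delta_p(x)$, $d_{\vec v}f(p)$ being the directional derivative at $p$ along $\vec v$. *)

theory Defs
  imports "HOL-Analysis.Analysis" "Graph_Theory.Digraph_Component"
begin

text \<open>
  A metrized graph is a finite connected multigraph, loops allowed, together with positive edge
  lengths.  The orientation of the arcs serves only to identify the edge \<open>e\<close> with the
  interval \<open>[0, len e]\<close>, the tail being at \<open>0\<close> and the head at \<open>len e\<close>.
  As \<open>connected\<close> requires a vertex, the vertex set is non-empty; all points of valence
  other than 2 are vertices by construction.
\<close>

record ('v, 'e) mgraph =
  dg :: "('v, 'e) pre_digraph"
  len :: "'e \<Rightarrow> real"

definition metrized_graph :: "('v, 'e) mgraph \<Rightarrow> bool" where
  "metrized_graph \<Gamma> \<longleftrightarrow>
     fin_digraph (dg \<Gamma>) \<and> Digraph_Component.connected (dg \<Gamma>) \<and>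
     (\<forall>e\<in>arcs (dg \<Gamma>). 0 < len \<Gamma> e)"

text \<open>
  \<open>Inner e t\<close> is the point of the edge \<open>e\<close> at distance \<open>t\<close> from its tail,
  strictly between the two ends.
\<close>

datatype ('v, 'e) pt = Vert 'v | Inner 'e real

definition points :: "('v, 'e) mgraph \<Rightarrow> ('v, 'e) pt set" where
  "points \<Gamma> = Vert ` verts (dg \<Gamma>) \<union>
     {Inner e t | e t. e \<in> arcs (dg \<Gamma>) \<and> 0 < t \<and> t < len \<Gamma> e}"

definition edge_pt :: "('v, 'e) mgraph \<Rightarrow> 'e \<Rightarrow> real \<Rightarrow> ('v, 'e) pt" where
  "edge_pt \<Gamma> e t =
     (if t = 0 then Vert (tail (dg \<Gamma>) e)
      else if t = len \<Gamma> e then Vert (head (dg \<Gamma>) e)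
      else Inner e t)"

definition integral_dx :: "('v, 'e) mgraph \<Rightarrow> (('v, 'e) pt \<Rightarrow> real) \<Rightarrow> real" where
  "integral_dx \<Gamma> g = (\<Sum>e\<in>arcs (dg \<Gamma>). LBINT t:{0..len \<Gamma> e}. g (edge_pt \<Gamma> e t))"

text \<open>
  The derivative along edges is taken in the direction of the orientation; the products of two
  such derivatives occurring below, and second derivatives, do not depend on the orientation.
  The value at vertices is a dummy, irrelevant for integration against \<open>dx\<close>.
\<close>

definition ddx :: "('v, 'e) mgraph \<Rightarrow> (('v, 'e) pt \<Rightarrow> real) \<Rightarrow> ('v, 'e) pt \<Rightarrow> real" where
  "ddx \<Gamma> f x = (case x of Vert v \<Rightarrow> 0 | Inner e t \<Rightarrow> deriv (\<lambda>s. f (edge_pt \<Gamma> e s)) t)"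

text \<open>
  The direction \<open>(e, t, s)\<close> at the point \<open>edge_pt \<Gamma> e t\<close> leads along \<open>e\<close>
  towards its head if \<open>s = 1\<close> and towards its tail if \<open>s = -1\<close>.  A loop contributes two
  directions at its vertex.
\<close>

definition directions :: "('v, 'e) mgraph \<Rightarrow> ('v, 'e) pt \<Rightarrow> ('e \<times> real \<times> real) set" where
  "directions \<Gamma> x =
     {(e, t, s). e \<in> arcs (dg \<Gamma>) \<and> 0 \<le> t \<and> t \<le> len \<Gamma> e \<and> edge_pt \<Gamma> e t = x \<and>
        (s = 1 \<and> t < len \<Gamma> e \<or> s = - 1 \<and> 0 < t)}"

definition dir_deriv ::
  "('v, 'e) mgraph \<Rightarrow> (('v, 'e) pt \<Rightarrow> real) \<Rightarrow> 'e \<times> real \<times> real \<Rightarrow> real" where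
  "dir_deriv \<Gamma> f d = (case d of (e, t, s) \<Rightarrow>
     Lim (at_right 0) (\<lambda>h. (f (edge_pt \<Gamma> e (t + s * h)) - f (edge_pt \<Gamma> e t)) / h))"

text \<open>
  The potential \<open>f\<close> of the circuit when unit current enters at \<open>y\<close> and exits at
  \<open>z\<close>, grounded at \<open>z\<close>.  Ohm's law: on every segment not containing a vertex,
  \<open>y\<close> or \<open>z\<close> in its interior there is a constant current \<open>i\<close>, and the potential
  drop is \<open>i\<close> times the length (the resistance).  In particular \<open>f\<close> is continuous and
  the current leaving a point in a given direction is minus the directional derivative.
  Kirchhoff's law: the net current leaving a point along the circuit equals the current fed in
  from outside.
\<close>

definition is_potential ::
  "('v, 'e) mgraph \<Rightarrow> ('v, 'e) pt \<Rightarrow> ('v, 'e) pt \<Rightarrow> (('v, 'e) pt \<Rightarrow> real) \<Rightarrow> bool" where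
  "is_potential \<Gamma> y z f \<longleftrightarrow>
     (\<forall>e\<in>arcs (dg \<Gamma>). \<forall>a b. 0 \<le> a \<and> a < b \<and> b \<le> len \<Gamma> e \<and>
        edge_pt \<Gamma> e ` {a<..<b} \<inter> {y, z} = {} \<longrightarrow>
        (\<exists>i. \<forall>t\<in>{a..b}. f (edge_pt \<Gamma> e a) - f (edge_pt \<Gamma> e t) = i * (t - a))) \<and>
     (\<forall>x\<in>points \<Gamma>.
        (\<Sum>d\<in>directions \<Gamma> x. - dir_deriv \<Gamma> f d) = of_bool (x = y) - of_bool (x = z)) \<and>
     f z = 0"

text \<open>\<open>jf \<Gamma> z x y\<close> is \<open>j_z(x, y)\<close>.\<close>

definition jf ::
  "('v, 'e) mgraph \<Rightarrow> ('v, 'e) pt \<Rightarrow> ('v, 'e) pt \<Rightarrow> ('v, 'e) pt \<Rightarrow> real" where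
  "jf \<Gamma> z x y = (THE c. \<exists>f. is_potential \<Gamma> y z f \<and> f x = c)"

definition resistance :: "('v, 'e) mgraph \<Rightarrow> ('v, 'e) pt \<Rightarrow> ('v, 'e) pt \<Rightarrow> real" where
  "resistance \<Gamma> x y = jf \<Gamma> x y y"

definition A_const :: "('v, 'e) mgraph \<Rightarrow> ('v, 'e) pt \<Rightarrow> ('v, 'e) pt \<Rightarrow> real" where
  "A_const \<Gamma> p q = integral_dx \<Gamma> (\<lambda>x. jf \<Gamma> x p q * (ddx \<Gamma> (\<lambda>x. jf \<Gamma> p x q) x)\<^sup>2)"

text \<open>
  A signed measure on \<open>\<Gamma>\<close> of the form \<open>h dx + (\<Sum>x. m x * \<delta>_x)\<close>, where \<open>m\<close>
  has finite support, is represented by the pair \<open>(h, m)\<close>.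
\<close>

type_synonym ('v, 'e) smeasure = "(('v, 'e) pt \<Rightarrow> real) \<times> (('v, 'e) pt \<Rightarrow> real)"

definition integral_sm ::
  "('v, 'e) mgraph \<Rightarrow> (('v, 'e) pt \<Rightarrow> real) \<Rightarrow> ('v, 'e) smeasure \<Rightarrow> real" where
  "integral_sm \<Gamma> g \<mu> =
     integral_dx \<Gamma> (\<lambda>x. g x * fst \<mu> x) + (\<Sum>x | x \<in> points \<Gamma> \<and> snd \<mu> x \<noteq> 0. g x * snd \<mu> x)"

text \<open>
  The vertex set in the definition of the Laplacian of \<open>f\<close> is any finite set, containing the
  vertices of the graph, off which \<open>f\<close> is \<open>C\<^sup>2\<close>.  At the remaining points
  the two directional derivatives of \<open>f\<close> cancel, so one may let every point carry the mass
  given by the formula; \<open>integral_sm_laplacian\<close> recovers the version with an explicit vertex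
  set.
\<close>

definition laplacian ::
  "('v, 'e) mgraph \<Rightarrow> (('v, 'e) pt \<Rightarrow> real) \<Rightarrow> ('v, 'e) smeasure" where
  "laplacian \<Gamma> f =
     (\<lambda>x. - ddx \<Gamma> (ddx \<Gamma> f) x, \<lambda>x. - (\<Sum>d\<in>directions \<Gamma> x. dir_deriv \<Gamma> f d))"

lemma directions_Inner:
  assumes "e \<in> arcs (dg \<Gamma>)" "0 < t" "t < len \<Gamma> e"
  shows "directions \<Gamma> (Inner e t) = {(e, t, 1), (e, t, - 1)}"
  using assms by (auto simp: directions_def edge_pt_def split: if_splits)

lemma dir_deriv_eqI:
  fixes f :: "('v, 'e) pt \<Rightarrow> real"
  assumes "((\<lambda>u. f (edge_pt \<Gamma> e u)) has_real_derivative D) (at t)" and "s = 1 \<or> s = - 1"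
  shows "dir_deriv \<Gamma> f (e, t, s) = s * D"
proof -
  have "((\<lambda>h. f (edge_pt \<Gamma> e (t + s * h))) has_real_derivative D * s) (at 0)"
    by (rule DERIV_chain2[where g = "\<lambda>h. t + s * h"])
      (use assms in \<open>auto intro!: derivative_eq_intros\<close>)
  then have "((\<lambda>h. (f (edge_pt \<Gamma> e (t + s * h)) - f (edge_pt \<Gamma> e t)) / h) \<longlongrightarrow> D * s) (at 0)"
    by (simp add: DERIV_def)
  then have "((\<lambda>h. (f (edge_pt \<Gamma> e (t + s * h)) - f (edge_pt \<Gamma> e t)) / h) \<longlongrightarrow> D * s) (at_right 0)"
    by (rule tendsto_within_subset) simp
  then show ?thesis
    by (simp add: dir_deriv_def tendsto_Lim mult.commute)
qed

lemma integral_sm_laplacian: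
  assumes "finite S" and "Vert ` verts (dg \<Gamma>) \<subseteq> S" and "S \<subseteq> points \<Gamma>"
    and diff: "\<And>e t. Inner e t \<in> points \<Gamma> - S \<Longrightarrow>
      (\<lambda>s. f (edge_pt \<Gamma> e s)) differentiable at t"
  shows "integral_sm \<Gamma> g (laplacian \<Gamma> f) =
    integral_dx \<Gamma> (\<lambda>x. g x * - ddx \<Gamma> (ddx \<Gamma> f) x) -
    (\<Sum>x\<in>S. g x * (\<Sum>d\<in>directions \<Gamma> x. dir_deriv \<Gamma> f d))"
proof -
  have zero: "(\<Sum>d\<in>directions \<Gamma> x. dir_deriv \<Gamma> f d) = 0" if x: "x \<in> points \<Gamma> - S" for x
  proof -
    from x assms(2) obtain e t where et: "x = Inner e t" "e \<in> arcs (dg \<Gamma>)" "0 < t" "t < len \<Gamma> e"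
      by (auto simp: points_def)
    from diff[of e t] x et obtain D
      where D: "((\<lambda>s. f (edge_pt \<Gamma> e s)) has_real_derivative D) (at t)"
      by (auto simp: real_differentiable_def)
    show ?thesis
      using et dir_deriv_eqI[OF D, of 1] dir_deriv_eqI[OF D, of "- 1"]
      by (simp add: directions_Inner)
  qed
  let ?m = "\<lambda>x. \<Sum>d\<in>directions \<Gamma> x. dir_deriv \<Gamma> f d"
  have "(\<Sum>x | x \<in> points \<Gamma> \<and> - ?m x \<noteq> 0. g x * - ?m x) = (\<Sum>x\<in>S. g x * - ?m x)"
    by (rule sum.mono_neutral_left) (use assms(1,3) zero in \<open>force+\<close>)
  then show ?thesis
    by (simp add: integral_sm_def laplacian_def sum_negf)
qed

end

theory Submission
  imports Defs "Jordan_Normal_Form.Determinant"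
begin

text \<open>
  Write \<open>J(x) = j_p(x,q)\<close>, \<open>K(x) = j_x(p,q)\<close> and \<open>r = r(p,q)\<close>.  Superposition of
  potentials gives \<open>j_q(x,p) = r - J(x)\<close> and \<open>r(p,x) = J(x) + K(x)\<close>.  By Green's identity
  \<open>\<integral> g \<Delta>f = \<integral> f' g' dx\<close>, and as \<open>\<Delta>J = \<delta>_q - \<delta>_p\<close>, one has
  \<open>\<integral> J' g' dx = g(q) - g(p)\<close> for every piecewise smooth \<open>g\<close>.  The choices \<open>g = K\<close>,
  \<open>g = J K\<close> and \<open>g = J\<^sup>2\<close>, with \<open>J(p) = K(p) = K(q) = 0\<close> and \<open>J(q) = r\<close>, yield all the equalities.

  Green's identity also shows that potentials are unique.  They exist because the Laplacian of the
  underlying weighted graph, grounded at one vertex, is injective, hence surjective; sources at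
  inner points of an edge are reduced to sources at its two ends by adding a tent function.  The
  resulting formula is quadratic on the diagonal of every edge, so \<open>K\<close> is piecewise quadratic.
\<close>

subsection \<open>Linear systems and integrals over intervals\<close>

unbundle no vec_syntax

text \<open>Enumerating \<open>V\<close> turns \<open>A\<close> into a square matrix. A trivial
  kernel means a nonzero determinant, so there is an inverse to apply to the right-hand
  side.\<close>

lemma injective_square_system_solvable:
  fixes A :: "'v \<Rightarrow> 'v \<Rightarrow> real"
  assumes fin: "finite V"
    and inj: "\<And>h. \<forall>v\<in>V. (\<Sum>w\<in>V. A v w * h w) = 0 \<Longrightarrow> \<forall>v\<in>V. h v = 0"
  shows "\<exists>h. \<forall>v\<in>V. (\<Sum>w\<in>V. A v w * h w) = b v"
proof -
  define n where "n = card V"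
  obtain f where f: "bij_betw f {0..<n} V"
    using ex_bij_betw_nat_finite[OF fin] unfolding n_def by blast
  define g where "g = inv_into {0..<n} f"
  have gf: "g (f i) = i" if "i < n" for i
    using that f by (simp add: g_def bij_betw_inv_into_left)
  have fV: "\<exists>i<n. v = f i" if "v \<in> V" for v
    using that f by (auto simp: bij_betw_def)
  define M where "M = mat n n (\<lambda>(i, j). A (f i) (f j))"
  have M: "M \<in> carrier_mat n n" by (simp add: M_def)
  have Mv: "(M *\<^sub>v x) $ i = (\<Sum>w\<in>V. A (f i) w * x $ g w)"
    if "x \<in> carrier_vec n" "i < n" for x i
  proof -
    have "(M *\<^sub>v x) $ i = (\<Sum>j\<in>{0..<n}. A (f i) (f j) * x $ g (f j))"
      using that by (auto simp: M_def scalar_prod_def gf intro!: sum.cong)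
    also have "\<dots> = (\<Sum>w\<in>V. A (f i) w * x $ g w)"
      by (rule sum.reindex_bij_betw[OF f])
    finally show ?thesis .
  qed
  have "det M \<noteq> 0"
  proof
    assume "det M = 0"
    then obtain x where x: "x \<in> carrier_vec n" "x \<noteq> 0\<^sub>v n" "M *\<^sub>v x = 0\<^sub>v n"
      using det_0_iff_vec_prod_zero_field[OF M] by blast
    have "\<forall>v\<in>V. (\<Sum>w\<in>V. A v w * x $ g w) = 0"
      using fV Mv[OF x(1)] x(3) by (metis index_zero_vec(1))
    then have "\<forall>v\<in>V. x $ g v = 0" by (rule inj)
    then have "x = 0\<^sub>v n"
      using f x(1) gf by (intro eq_vecI) (auto simp: bij_betw_def)
    with x(2) show False by simp
  qed
  then have "M \<in> Units (ring_mat TYPE(real) n ())"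
    by (rule det_non_zero_imp_unit[OF M])
  then obtain B where B: "B \<in> carrier_mat n n" "M * B = 1\<^sub>m n"
    by (auto simp: Units_def ring_mat_def)
  define x where "x = B *\<^sub>v vec n (\<lambda>i. b (f i))"
  have x: "x \<in> carrier_vec n" using B by (simp add: x_def)
  have "M *\<^sub>v x = vec n (\<lambda>i. b (f i))"
    using M B by (simp add: x_def flip: assoc_mult_mat_vec[of _ n n _ n])
  then have "\<forall>v\<in>V. (\<Sum>w\<in>V. A v w * x $ g w) = b v"
    using fV Mv[OF x] by (metis index_vec)
  then show ?thesis by (intro exI[of _ "\<lambda>w. vec_index x (g w)"])
qed

text \<open>Induction on the number of points of \<open>T\<close> inside the interval: cutting at
  one of them leaves fewer on either side. It carries facts from segments without break points to
  whole edges.\<close>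

lemma interval_partition_induct:
  fixes a b :: real
  assumes "finite T" "a < b"
    and base: "\<And>c d. a \<le> c \<Longrightarrow> c < d \<Longrightarrow> d \<le> b \<Longrightarrow> {c<..<d} \<inter> T = {} \<Longrightarrow> Q c d"
    and join: "\<And>c m d. a \<le> c \<Longrightarrow> c < m \<Longrightarrow> m < d \<Longrightarrow> d \<le> b \<Longrightarrow> m \<in> T \<Longrightarrow> Q c m \<Longrightarrow> Q m d \<Longrightarrow> Q c d"
  shows "Q a b"
proof -
  have "Q c d" if "a \<le> c" "c < d" "d \<le> b" for c d
    using that
  proof (induction "card ({c<..<d} \<inter> T)" arbitrary: c d rule: less_induct)
    case less
    show ?case
    proof (cases "{c<..<d} \<inter> T = {}")
      case True
      then show ?thesis using base less.prems by blast
    next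
      case False
      then obtain m where m: "c < m" "m < d" "m \<in> T" by auto
      have "{c<..<m} \<inter> T \<subset> {c<..<d} \<inter> T" "{m<..<d} \<inter> T \<subset> {c<..<d} \<inter> T"
        using m by auto
      then have "card ({c<..<m} \<inter> T) < card ({c<..<d} \<inter> T)"
          "card ({m<..<d} \<inter> T) < card ({c<..<d} \<inter> T)"
        using \<open>finite T\<close> by (auto intro!: psubset_card_mono)
      then show ?thesis
        using less m join[of c m d] by force
    qed
  qed
  with \<open>a < b\<close> show ?thesis by simp
qed

section \<open>Limits and integrals over intervals\<close>

lemma Lim_cong:
  assumes "eventually (\<lambda>x. f x = g x) F"
  shows "Lim F f = Lim F g"
  using tendsto_cong[OF assms] by (simp add: Topological_Spaces.Lim_def)

text \<open>The two ends are a null set; in the application the integrand is controlled only between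
  them.\<close>

lemma set_integrable_cong_interior:
  fixes u v :: "real \<Rightarrow> real"
  assumes "\<And>t. t \<in> {a<..<b} \<Longrightarrow> u t = v t"
  shows "set_integrable lborel {a..b} u = set_integrable lborel {a..b} v"
  unfolding set_integrable_def
  by (rule integrable_discrete_difference[where X = "{a, b}"])
    (use assms in \<open>auto simp: indicator_def\<close>)

lemma set_integral_cong_countable:
  fixes u v :: "real \<Rightarrow> real"
  assumes "countable X" "\<And>t. t \<in> {a..b} - X \<Longrightarrow> u t = v t"
  shows "(LBINT t:{a..b}. u t) = (LBINT t:{a..b}. v t)"
  unfolding set_lebesgue_integral_def
  by (rule integral_discrete_difference[where X = X])
    (use assms in \<open>auto simp: indicator_def\<close>)

lemma set_integral_Icc_split:
  fixes u :: "real \<Rightarrow> real"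
  assumes "a \<le> m" "m \<le> b" "set_integrable lborel {a..b} u"
  shows "(LBINT t:{a..b}. u t) = (LBINT t:{a..m}. u t) + (LBINT t:{m..b}. u t)"
proof -
  have "interval_lebesgue_integrable lborel (ereal a) (ereal b) u"
    using assms unfolding interval_lebesgue_integrable_def
    by (auto intro: set_integrable_subset)
  then have "(LBINT t=a..m. u t) + (LBINT t=m..b. u t) = (LBINT t=a..b. u t)"
    using assms by (intro interval_integral_sum) (simp add: min_def max_def)
  then show ?thesis
    using assms by (simp add: interval_integral_Icc)
qed

lemma set_integral_poly_pderiv:
  fixes R :: "real poly"
  assumes "c \<le> d"
  shows "(LBINT t:{c..d}. poly (pderiv R) t) = poly R d - poly R c"
proof -
  have "(LBINT t=c..d. poly (pderiv R) t) = poly R d - poly R c"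
    by (rule interval_integral_FTC_finite)
      (auto intro!: continuous_intros DERIV_subset[OF poly_DERIV]
        simp flip: has_real_derivative_iff_has_vector_derivative)
  then show ?thesis
    using assms by (simp add: interval_integral_Icc)
qed

lemma set_integrable_poly: "set_integrable lborel {c..d} (poly (R :: real poly))"
  by (intro borel_integrable_atLeastAtMost' continuous_intros)

section \<open>Points, edges and connectedness of a metrized graph\<close>

locale metrized =
  fixes \<Gamma> :: "('v, 'e) mgraph"
  assumes metrized_graph: "metrized_graph \<Gamma>"
begin

abbreviation "V \<equiv> verts (dg \<Gamma>)"
abbreviation "E \<equiv> arcs (dg \<Gamma>)"
abbreviation "L \<equiv> len \<Gamma>"
abbreviation "src \<equiv> tail (dg \<Gamma>)"
abbreviation "tgt \<equiv> head (dg \<Gamma>)"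
abbreviation "ept \<equiv> edge_pt \<Gamma>"
abbreviation "pts \<equiv> points \<Gamma>"
abbreviation "dirs \<equiv> directions \<Gamma>"
abbreviation "dird \<equiv> dir_deriv \<Gamma>"
abbreviation "dx \<equiv> ddx \<Gamma>"
abbreviation "Int_dx \<equiv> integral_dx \<Gamma>"

sublocale fin_digraph "dg \<Gamma>"
  using metrized_graph by (simp add: metrized_graph_def)

lemma len_pos: "e \<in> E \<Longrightarrow> 0 < L e"
  using metrized_graph by (simp add: metrized_graph_def)

lemma ept_0 [simp]: "ept e 0 = Vert (src e)"
  by (simp add: edge_pt_def)

lemma ept_len [simp]: "e \<in> E \<Longrightarrow> ept e (L e) = Vert (tgt e)"
  using len_pos[of e] by (simp add: edge_pt_def)

lemma ept_inner: "0 < t \<Longrightarrow> t < L e \<Longrightarrow> ept e t = Inner e t"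
  by (simp add: edge_pt_def)

lemma Vert_in_pts [simp]: "Vert v \<in> pts \<longleftrightarrow> v \<in> V"
  by (auto simp: points_def)

lemma Inner_in_pts [simp]: "Inner e t \<in> pts \<longleftrightarrow> e \<in> E \<and> 0 < t \<and> t < L e"
  by (auto simp: points_def)

lemma ept_in_pts: "e \<in> E \<Longrightarrow> 0 \<le> t \<Longrightarrow> t \<le> L e \<Longrightarrow> ept e t \<in> pts"
  by (auto simp: edge_pt_def)

text \<open>Connectedness is strong connectedness of the symmetrised digraph, each of whose steps
  runs along an arc forwards or backwards; the claim follows by induction along a walk.\<close>

lemma constant_on_vertices:
  assumes "\<And>e. e \<in> E \<Longrightarrow> \<phi> (src e) = \<phi> (tgt e)" and "u \<in> V" "v \<in> V"
  shows "\<phi> u = \<phi> v"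
proof -
  have "u \<rightarrow>\<^sup>*\<^bsub>with_proj (mk_symmetric (dg \<Gamma>))\<^esub> v"
    using metrized_graph assms(2,3)
    by (auto simp: metrized_graph_def Digraph_Component.connected_def strongly_connected_def)
  then have "(u, v) \<in> rtrancl_on V (parcs (mk_symmetric (dg \<Gamma>)))"
    by (simp add: reachable_def)
  then show ?thesis
    by induction (auto simp: parcs_mk_symmetric assms(1))
qed

subsection \<open>Piecewise polynomial functions\<close>

text \<open>The ends \<open>a\<close> and \<open>b\<close> may lie on \<open>S\<close>: these are
  the segments on which \<open>is_potential\<close> imposes Ohm's law, with \<open>S\<close>
  consisting of source and sink.\<close>

definition free :: "('v, 'e) pt set \<Rightarrow> 'e \<Rightarrow> real \<Rightarrow> real \<Rightarrow> bool" where
  "free S e a b \<longleftrightarrow> e \<in> E \<and> 0 \<le> a \<and> a < b \<and> b \<le> L e \<and> ept e ` {a<..<b} \<inter> S = {}"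

text \<open>Vertices in \<open>S\<close> are left out, since every segment stops at the ends of its
  edge anyway.\<close>

definition brk :: "('v, 'e) pt set \<Rightarrow> 'e \<Rightarrow> real set" where
  "brk S e = {t. 0 < t \<and> t < L e \<and> Inner e t \<in> S}"

lemma finite_brk: "finite S \<Longrightarrow> finite (brk S e)"
  by (rule finite_subset[of _ "Inner e -` S"]) (auto simp: brk_def intro: finite_vimageI injI)

lemma free_iff:
  "free S e a b \<longleftrightarrow> e \<in> E \<and> 0 \<le> a \<and> a < b \<and> b \<le> L e \<and> {a<..<b} \<inter> brk S e = {}"
  by (auto simp: free_def brk_def ept_inner disjoint_iff)

lemma free_right:
  assumes "finite S" "e \<in> E" "0 \<le> t" "t < L e"
  obtains b where "free S e t b"
proof
  \<comment> \<open>The minimum is the nearest break point to the right of \<open>t\<close>, or the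
    head of the edge if there is none.\<close>
  let ?B = "insert (L e) (brk S e \<inter> {t<..})"
  have fin: "finite ?B" using finite_brk assms by auto
  show "free S e t (Min ?B)"
    using assms Min_in[OF fin] Min_le[OF fin] by (fastforce simp: free_iff)
qed

lemma free_left:
  assumes "finite S" "e \<in> E" "0 < t" "t \<le> L e"
  obtains a where "free S e a t"
proof
  let ?B = "insert 0 (brk S e \<inter> {..<t})"
  have fin: "finite ?B" using finite_brk assms by auto
  show "free S e (Max ?B) t"
    using assms Max_in[OF fin] Max_ge[OF fin] by (fastforce simp: free_iff brk_def)
qed

text \<open>The point is not itself a break point, so the segments on its two sides merge into
  one.\<close>

lemma free_around:
  assumes "finite S" "Inner e t \<in> pts - S"
  obtains a b where "free S e a b" "a < t" "t < b"
proof -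
  obtain b where b: "free S e t b" using free_right[of S e t] assms by auto
  obtain a where a: "free S e a t" using free_left[of S e t] assms by auto
  have "{a<..<b} \<subseteq> {a<..<t} \<union> {t} \<union> {t<..<b}" by auto
  then have "free S e a b"
    using a b assms by (auto simp: free_iff brk_def disjoint_iff)
  with a b that show ?thesis by (auto simp: free_iff)
qed

text \<open>For finite \<open>S\<close>, agreement with polynomials on closed segments forces
  continuity at break points and vertices, while slopes may jump there.\<close>

definition pw_poly :: "('v, 'e) pt set \<Rightarrow> nat \<Rightarrow> (('v, 'e) pt \<Rightarrow> real) \<Rightarrow> bool" where
  "pw_poly S n f \<longleftrightarrow> (\<forall>e a b. free S e a b \<longrightarrow>
     (\<exists>P. degree P \<le> n \<and> (\<forall>t\<in>{a..b}. f (ept e t) = poly P t)))"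

text \<open>The variant on open segments is meant for derivatives, which may jump at break points
  and have dummy values at vertices.\<close>

definition pw_poly_inner :: "('v, 'e) pt set \<Rightarrow> (('v, 'e) pt \<Rightarrow> real) \<Rightarrow> bool" where
  "pw_poly_inner S f \<longleftrightarrow> (\<forall>e a b. free S e a b \<longrightarrow>
     (\<exists>P. \<forall>t\<in>{a<..<b}. f (ept e t) = poly P t))"

lemma pw_polyI:
  assumes "\<And>e a b. free S e a b \<Longrightarrow> \<exists>P. degree P \<le> n \<and> (\<forall>t\<in>{a..b}. f (ept e t) = poly P t)"
  shows "pw_poly S n f"
  using assms by (simp add: pw_poly_def)

lemma pw_polyE:
  assumes "pw_poly S n f" "free S e a b"
  obtains P where "degree P \<le> n" "\<And>t. t \<in> {a..b} \<Longrightarrow> f (ept e t) = poly P t"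
  using assms unfolding pw_poly_def by meson

lemma pw_poly_innerI:
  assumes "\<And>e a b. free S e a b \<Longrightarrow> \<exists>P. \<forall>t\<in>{a<..<b}. f (ept e t) = poly P t"
  shows "pw_poly_inner S f"
  using assms by (simp add: pw_poly_inner_def)

lemma pw_poly_innerE:
  assumes "pw_poly_inner S f" "free S e a b"
  obtains P where "\<And>t. t \<in> {a<..<b} \<Longrightarrow> f (ept e t) = poly P t"
  using assms unfolding pw_poly_inner_def by meson

lemma pw_poly_imp_inner:
  assumes "pw_poly S n f"
  shows "pw_poly_inner S f"
proof (rule pw_poly_innerI)
  fix e a b assume "free S e a b"
  from pw_polyE[OF assms this] show "\<exists>P. \<forall>t\<in>{a<..<b}. f (ept e t) = poly P t"
    by (metis atLeastAtMost_iff greaterThanLessThan_iff less_imp_le)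
qed

lemma pw_poly_mono:
  assumes "pw_poly S n f" "S \<subseteq> S'" "n \<le> m"
  shows "pw_poly S' m f"
proof (rule pw_polyI)
  fix e a b assume "free S' e a b"
  then have "free S e a b" using assms(2) by (auto simp: free_def)
  from pw_polyE[OF assms(1) this] obtain P
    where "degree P \<le> n" "\<And>t. t \<in> {a..b} \<Longrightarrow> f (ept e t) = poly P t" by blast
  then show "\<exists>P. degree P \<le> m \<and> (\<forall>t\<in>{a..b}. f (ept e t) = poly P t)"
    using assms(3) by (intro exI[of _ P]) auto
qed

lemma pw_poly_cong:
  assumes "\<And>x. x \<in> pts \<Longrightarrow> f x = g x" "pw_poly S n f"
  shows "pw_poly S n g"
proof (rule pw_polyI)
  fix e a b assume *: "free S e a b"
  from pw_polyE[OF assms(2) this] obtain P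
    where "degree P \<le> n" "\<And>t. t \<in> {a..b} \<Longrightarrow> f (ept e t) = poly P t" by blast
  moreover have "f (ept e t) = g (ept e t)" if "t \<in> {a..b}" for t
    using assms(1) ept_in_pts[of e t] * that by (auto simp: free_def)
  ultimately show "\<exists>P. degree P \<le> n \<and> (\<forall>t\<in>{a..b}. g (ept e t) = poly P t)" by auto
qed

lemma pw_poly_const: "pw_poly S n (\<lambda>x. c)"
  by (rule pw_polyI) (rule exI[of _ "[:c:]"], simp)

lemma pw_poly_lincomb:
  assumes "pw_poly S n f" "pw_poly S n g"
  shows "pw_poly S n (\<lambda>x. c * f x + d * g x)"
proof (rule pw_polyI)
  fix e a b assume *: "free S e a b"
  obtain P where P: "degree P \<le> n" "\<And>t. t \<in> {a..b} \<Longrightarrow> f (ept e t) = poly P t"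
    using pw_polyE[OF assms(1) *] by blast
  obtain Q where Q: "degree Q \<le> n" "\<And>t. t \<in> {a..b} \<Longrightarrow> g (ept e t) = poly Q t"
    using pw_polyE[OF assms(2) *] by blast
  show "\<exists>P. degree P \<le> n \<and> (\<forall>t\<in>{a..b}. c * f (ept e t) + d * g (ept e t) = poly P t)"
    using P Q by (intro exI[of _ "Polynomial.smult c P + Polynomial.smult d Q"])
      (auto intro!: degree_add_le intro: order_trans[OF degree_smult_le])
qed

lemma pw_poly_add: "pw_poly S n f \<Longrightarrow> pw_poly S n g \<Longrightarrow> pw_poly S n (\<lambda>x. f x + g x)"
  using pw_poly_lincomb[of S n f g 1 1] by simp

lemma pw_poly_diff: "pw_poly S n f \<Longrightarrow> pw_poly S n g \<Longrightarrow> pw_poly S n (\<lambda>x. f x - g x)"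
  using pw_poly_lincomb[of S n f g 1 "-1"] by simp

lemma pw_poly_mult:
  assumes "pw_poly S n f" "pw_poly S m g"
  shows "pw_poly S (n + m) (\<lambda>x. f x * g x)"
proof (rule pw_polyI)
  fix e a b assume *: "free S e a b"
  obtain P where P: "degree P \<le> n" "\<And>t. t \<in> {a..b} \<Longrightarrow> f (ept e t) = poly P t"
    using pw_polyE[OF assms(1) *] by blast
  obtain Q where Q: "degree Q \<le> m" "\<And>t. t \<in> {a..b} \<Longrightarrow> g (ept e t) = poly Q t"
    using pw_polyE[OF assms(2) *] by blast
  show "\<exists>P. degree P \<le> n + m \<and> (\<forall>t\<in>{a..b}. f (ept e t) * g (ept e t) = poly P t)"
    using P Q by (intro exI[of _ "P * Q"])
      (auto intro!: order_trans[OF degree_mult_le])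
qed

lemma pw_poly_inner_mult:
  assumes "pw_poly_inner S f" "pw_poly_inner S g"
  shows "pw_poly_inner S (\<lambda>x. f x * g x)"
proof (rule pw_poly_innerI)
  fix e a b assume *: "free S e a b"
  obtain P where P: "\<And>t. t \<in> {a<..<b} \<Longrightarrow> f (ept e t) = poly P t"
    using pw_poly_innerE[OF assms(1) *] by blast
  obtain Q where Q: "\<And>t. t \<in> {a<..<b} \<Longrightarrow> g (ept e t) = poly Q t"
    using pw_poly_innerE[OF assms(2) *] by blast
  show "\<exists>P. \<forall>t\<in>{a<..<b}. f (ept e t) * g (ept e t) = poly P t"
    using P Q by (intro exI[of _ "P * Q"]) auto
qed

lemma pw_poly_inner_lincomb:
  assumes "pw_poly_inner S f" "pw_poly_inner S g"
  shows "pw_poly_inner S (\<lambda>x. c * f x + d * g x)"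
proof (rule pw_poly_innerI)
  fix e a b assume *: "free S e a b"
  obtain P where P: "\<And>t. t \<in> {a<..<b} \<Longrightarrow> f (ept e t) = poly P t"
    using pw_poly_innerE[OF assms(1) *] by blast
  obtain Q where Q: "\<And>t. t \<in> {a<..<b} \<Longrightarrow> g (ept e t) = poly Q t"
    using pw_poly_innerE[OF assms(2) *] by blast
  show "\<exists>P. \<forall>t\<in>{a<..<b}. c * f (ept e t) + d * g (ept e t) = poly P t"
    using P Q by (intro exI[of _ "Polynomial.smult c P + Polynomial.smult d Q"]) auto
qed

section \<open>Derivatives of piecewise polynomial functions\<close>

lemma has_derivative_poly_inner:
  assumes P: "\<And>u. u \<in> {a<..<b} \<Longrightarrow> f (ept e u) = poly P u" and t: "t \<in> {a<..<b}"
  shows "((\<lambda>s. f (ept e s)) has_real_derivative poly (pderiv P) t) (at t)"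
  using has_field_derivative_transform_within_open[OF poly_DERIV[of P t], of "{a<..<b}"] assms
  by auto

lemma ddx_poly:
  assumes "\<And>u. u \<in> {a<..<b} \<Longrightarrow> f (ept e u) = poly P u" "t \<in> {a<..<b}" "0 \<le> a" "b \<le> L e"
  shows "dx f (ept e t) = poly (pderiv P) t"
  using DERIV_imp_deriv[OF has_derivative_poly_inner[of a b f e P t]] assms
  by (simp add: ddx_def ept_inner)

lemma pw_poly_inner_ddx:
  assumes "pw_poly_inner S f"
  shows "pw_poly_inner S (dx f)"
proof (rule pw_poly_innerI)
  fix e a b assume *: "free S e a b"
  obtain P where P: "\<And>t. t \<in> {a<..<b} \<Longrightarrow> f (ept e t) = poly P t"
    using pw_poly_innerE[OF assms(1) *] by blast
  show "\<exists>P. \<forall>t\<in>{a<..<b}. dx f (ept e t) = poly P t"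
    using ddx_poly[OF P] * by (auto simp: free_def)
qed

lemma has_ddx:
  assumes "finite S" "pw_poly_inner S f" "Inner e t \<in> pts - S"
  shows "((\<lambda>s. f (ept e s)) has_real_derivative dx f (Inner e t)) (at t)"
proof -
  obtain a b where ab: "free S e a b" "a < t" "t < b"
    using free_around[OF assms(1,3)] .
  obtain P where P: "\<And>t. t \<in> {a<..<b} \<Longrightarrow> f (ept e t) = poly P t"
    using pw_poly_innerE[OF assms(2) ab(1)] by blast
  show ?thesis
    using has_derivative_poly_inner[of a b f e P t] ddx_poly[of a b f e P t] P ab assms(3)
    by (auto simp: free_def ept_inner)
qed

text \<open>The condition on \<open>s\<close> says that the direction points into the segment, so
  for small \<open>h\<close> the quotient sees only values of \<open>P\<close>, even when
  \<open>t\<close> is an end of the segment.\<close>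

lemma dir_quotient_poly:
  assumes P: "\<And>u. u \<in> {a..b} \<Longrightarrow> f (ept e u) = poly P u"
    and t: "t \<in> {a..b}" "s = 1 \<and> t < b \<or> s = - 1 \<and> a < t"
  shows "((\<lambda>h. (f (ept e (t + s * h)) - f (ept e t)) / h) \<longlongrightarrow> s * poly (pderiv P) t) (at_right 0)"
proof -
  have "((\<lambda>h. poly P (t + s * h)) has_real_derivative poly (pderiv P) t * s) (at 0)"
    by (rule DERIV_chain2[where g = "\<lambda>h. t + s * h"]) (auto intro!: derivative_eq_intros)
  then have "((\<lambda>h. (poly P (t + s * h) - poly P t) / h) \<longlongrightarrow> s * poly (pderiv P) t) (at 0)"
    by (simp add: DERIV_def mult.commute)
  then have *: "((\<lambda>h. (poly P (t + s * h) - poly P t) / h) \<longlongrightarrow> s * poly (pderiv P) t) (at_right 0)"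
    by (rule tendsto_within_subset) simp
  have "eventually (\<lambda>h. h \<in> {0<..<max (b - t) (t - a)} \<and> t + s * h \<in> {a..b}) (at_right 0)"
  proof -
    \<comment> \<open>The bound is the room left in the segment on the side to which
      \<open>s\<close> points.\<close>
    have "eventually (\<lambda>h. h \<in> {0<..<if s = 1 then b - t else t - a}) (at_right 0)"
      using t by (intro eventually_at_right_real) auto
    then show ?thesis
      by eventually_elim (use t in \<open>auto split: if_splits\<close>)
  qed
  then have "eventually (\<lambda>h. (poly P (t + s * h) - poly P t) / h =
      (f (ept e (t + s * h)) - f (ept e t)) / h) (at_right 0)"
    by eventually_elim (use P t in auto)
  from tendsto_cong[OF this] * show ?thesis by simp
qed

lemma dir_deriv_poly:
  assumes "\<And>u. u \<in> {a..b} \<Longrightarrow> f (ept e u) = poly P u"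
    and "t \<in> {a..b}" "s = 1 \<and> t < b \<or> s = - 1 \<and> a < t"
  shows "dird f (e, t, s) = s * poly (pderiv P) t"
  using tendsto_Lim[OF _ dir_quotient_poly[OF assms]] by (simp add: dir_deriv_def)

text \<open>\<open>dir_deriv\<close> is a \<open>Lim\<close>, which can be calculated with only once
  convergence is known; linearity of directional derivatives rests on this.\<close>

lemma tendsto_dir_deriv:
  assumes "finite S" "pw_poly S n f" "(e, t, s) \<in> dirs x"
  shows "((\<lambda>h. (f (ept e (t + s * h)) - f (ept e t)) / h) \<longlongrightarrow> dird f (e, t, s)) (at_right 0)"
proof -
  have d: "e \<in> E" "0 \<le> t" "t \<le> L e" "s = 1 \<and> t < L e \<or> s = - 1 \<and> 0 < t"
    using assms(3) by (auto simp: directions_def)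
  obtain a b where ab: "free S e a b" "t \<in> {a..b}" "s = 1 \<and> t < b \<or> s = - 1 \<and> a < t"
  proof (cases "s = 1 \<and> t < L e")
    case True
    then obtain b where "free S e t b" using free_right[OF assms(1) d(1,2)] by blast
    then show ?thesis using that[of t b] True by (auto simp: free_def)
  next
    case False
    then obtain a where "free S e a t" using free_left[OF assms(1) d(1) _ d(3)] d by blast
    then show ?thesis using that[of a t] False d by (auto simp: free_def)
  qed
  obtain P where P: "\<And>t. t \<in> {a..b} \<Longrightarrow> f (ept e t) = poly P t"
    using pw_polyE[OF assms(2) ab(1)] by blast
  show ?thesis
    using dir_quotient_poly[OF P ab(2,3)] dir_deriv_poly[OF P ab(2,3)] by simp
qed

lemma dir_deriv_lincomb:
  assumes "finite S" "pw_poly S n f" "pw_poly S m g" "d \<in> dirs x"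
  shows "dird (\<lambda>x. a * f x + b * g x) d = a * dird f d + b * dird g d"
proof -
  obtain e t s where d: "d = (e, t, s)" by (cases d)
  have "((\<lambda>h. a * ((f (ept e (t + s * h)) - f (ept e t)) / h) +
      b * ((g (ept e (t + s * h)) - g (ept e t)) / h)) \<longlongrightarrow> a * dird f d + b * dird g d) (at_right 0)"
    using tendsto_dir_deriv[OF assms(1,2) assms(4)[unfolded d]]
      tendsto_dir_deriv[OF assms(1,3) assms(4)[unfolded d]]
    unfolding d by (intro tendsto_intros)
  then have "((\<lambda>h. (a * f (ept e (t + s * h)) + b * g (ept e (t + s * h)) -
      (a * f (ept e t) + b * g (ept e t))) / h) \<longlongrightarrow> a * dird f d + b * dird g d) (at_right 0)"
    by (simp add: add_divide_distrib diff_divide_distrib algebra_simps)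
  then show ?thesis
    unfolding d dir_deriv_def prod.case by (intro tendsto_Lim) simp_all
qed

lemma dir_deriv_cong:
  assumes "\<And>x. x \<in> pts \<Longrightarrow> f x = g x" "d \<in> dirs x"
  shows "dird f d = dird g d"
proof -
  obtain e t s where d: "d = (e, t, s)" by (cases d)
  have *: "e \<in> E" "0 \<le> t" "t \<le> L e" "s = 1 \<and> t < L e \<or> s = - 1 \<and> 0 < t"
    using assms(2) by (auto simp: d directions_def)
  have "eventually (\<lambda>h. h \<in> {0<..<if s = 1 then L e - t else t}) (at_right 0)"
    using * by (intro eventually_at_right_real) auto
  then have "eventually (\<lambda>h. (f (ept e (t + s * h)) - f (ept e t)) / h =
      (g (ept e (t + s * h)) - g (ept e t)) / h) (at_right 0)"
  proof eventually_elim
    case (elim h)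
    then have "ept e (t + s * h) \<in> pts"
      using * by (intro ept_in_pts) (auto split: if_splits)
    then show ?case
      using assms(1) ept_in_pts[OF *(1-3)] by simp
  qed
  then show ?thesis
    unfolding d dir_deriv_def prod.case by (rule Lim_cong)
qed

section \<open>Integration over the graph\<close>

lemma set_integrable_pw_poly:
  assumes "finite S" "pw_poly_inner S u" "e \<in> E"
  shows "set_integrable lborel {0..L e} (\<lambda>t. u (ept e t))"
proof (rule interval_partition_induct[OF finite_brk[OF assms(1), of e] len_pos[OF assms(3)]])
  fix c d assume *: "0 \<le> c" "c < d" "d \<le> L e" "{c<..<d} \<inter> brk S e = {}"
  then have "free S e c d" using assms(3) by (simp add: free_iff)
  then obtain P where "\<And>t. t \<in> {c<..<d} \<Longrightarrow> u (ept e t) = poly P t"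
    using pw_poly_innerE[OF assms(2)] by blast
  then show "set_integrable lborel {c..d} (\<lambda>t. u (ept e t))"
    using set_integrable_cong_interior[of c d "\<lambda>t. u (ept e t)" "poly P"] set_integrable_poly
    by blast
next
  fix c m d assume *: "c < m" "m < d"
    "set_integrable lborel {c..m} (\<lambda>t. u (ept e t))" "set_integrable lborel {m..d} (\<lambda>t. u (ept e t))"
  have "{c..d} = {c..m} \<union> {m..d}" using * by auto
  then show "set_integrable lborel {c..d} (\<lambda>t. u (ept e t))"
    using * by (simp add: set_integrable_Un)
qed

lemma Int_dx_lincomb:
  assumes "finite S" "pw_poly_inner S u" "pw_poly_inner S v"
  shows "Int_dx (\<lambda>x. a * u x + b * v x) = a * Int_dx u + b * Int_dx v"
proof -
  have "(LBINT t:{0..L e}. a * u (ept e t) + b * v (ept e t)) =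
      a * (LBINT t:{0..L e}. u (ept e t)) + b * (LBINT t:{0..L e}. v (ept e t))" if "e \<in> E" for e
    using set_integrable_pw_poly[OF assms(1,2) that] set_integrable_pw_poly[OF assms(1,3) that]
    by (subst set_integral_add(2)) auto
  then show ?thesis
    by (simp add: integral_dx_def sum.distrib sum_distrib_left)
qed

text \<open>On each edge the ends and the points of \<open>S\<close> are finitely many, hence a null
  set.\<close>

lemma Int_dx_cong:
  assumes "finite S" "\<And>e t. Inner e t \<in> pts - S \<Longrightarrow> u (Inner e t) = v (Inner e t)"
  shows "Int_dx u = Int_dx v"
  unfolding integral_dx_def
proof (rule sum.cong[OF refl])
  fix e assume e: "e \<in> E"
  show "(LBINT t:{0..L e}. u (ept e t)) = (LBINT t:{0..L e}. v (ept e t))"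
    by (rule set_integral_cong_countable[where X = "{0, L e} \<union> brk S e"])
      (use e finite_brk[OF assms(1), of e] assms(2) in
        \<open>auto simp: ept_inner brk_def intro!: countable_finite\<close>)
qed

subsection \<open>Green's identity\<close>

text \<open>On a segment without break points \<open>- g f'' - f' g' = - (g f')'\<close>, whose
  integral is the sum over both ends of \<open>g\<close> times the derivative of \<open>f\<close>
  into the segment. At a break point the contributions of the two adjoining segments add up.\<close>

lemma Green_on_edge:
  assumes S: "finite S" and f: "pw_poly S n f" and g: "pw_poly S m g" and e: "e \<in> E"
  shows "(LBINT t:{0..L e}. g (ept e t) * - dx (dx f) (ept e t) - dx f (ept e t) * dx g (ept e t)) =
    g (ept e 0) * dird f (e, 0, 1) + g (ept e (L e)) * dird f (e, L e, - 1) +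
    (\<Sum>t\<in>brk S e. g (ept e t) * (dird f (e, t, 1) + dird f (e, t, - 1)))"
proof -
  define u where "u x = g x * - dx (dx f) x - dx f x * dx g x" for x
  define h where "h t = g (ept e t) * (dird f (e, t, 1) + dird f (e, t, - 1))" for t
  define T where "T = brk S e"
  have T: "finite T" unfolding T_def by (rule finite_brk[OF S])
  have "pw_poly_inner S (\<lambda>x. (- 1) * (g x * dx (dx f) x) + (- 1) * (dx f x * dx g x))"
    by (intro pw_poly_inner_lincomb pw_poly_inner_mult pw_poly_inner_ddx
        pw_poly_imp_inner[OF f] pw_poly_imp_inner[OF g])
  then have u_int: "set_integrable lborel {0..L e} (\<lambda>t. u (ept e t))"
    using set_integrable_pw_poly[OF S _ e, of u] by (simp add: u_def[abs_def])
  \<comment> \<open>Intersecting \<open>T\<close> with the open edge gives a form that makes sense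
    on every subinterval, as the induction requires.\<close>
  have "(LBINT t:{0..L e}. u (ept e t)) =
      g (ept e 0) * dird f (e, 0, 1) + g (ept e (L e)) * dird f (e, L e, - 1) + sum h (T \<inter> {0<..<L e})"
  proof (rule interval_partition_induct[OF T len_pos[OF e]])
    fix c d assume *: "0 \<le> c" "c < d" "d \<le> L e" "{c<..<d} \<inter> T = {}"
    then have free: "free S e c d" using e by (simp add: free_iff T_def)
    obtain P where P: "\<And>t. t \<in> {c..d} \<Longrightarrow> f (ept e t) = poly P t"
      using pw_polyE[OF f free] by blast
    obtain Q where Q: "\<And>t. t \<in> {c..d} \<Longrightarrow> g (ept e t) = poly Q t"
      using pw_polyE[OF g free] by blast
    have dP: "dx f (ept e t) = poly (pderiv P) t" if "t \<in> {c<..<d}" for t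
      by (rule ddx_poly[of c d]) (use that P * in auto)
    have dQ: "dx g (ept e t) = poly (pderiv Q) t" if "t \<in> {c<..<d}" for t
      by (rule ddx_poly[of c d]) (use that Q * in auto)
    have ddP: "dx (dx f) (ept e t) = poly (pderiv (pderiv P)) t" if "t \<in> {c<..<d}" for t
      by (rule ddx_poly[of c d]) (use that dP * in auto)
    have "(LBINT t:{c..d}. u (ept e t)) = (LBINT t:{c..d}. poly (pderiv (- (Q * pderiv P))) t)"
      by (rule set_integral_cong_countable[where X = "{c, d}"])
        (use Q in \<open>auto simp: u_def dP dQ ddP pderiv_minus pderiv_mult\<close>)
    also have "\<dots> = poly Q c * poly (pderiv P) c - poly Q d * poly (pderiv P) d"
      using * by (subst set_integral_poly_pderiv) auto
    also have "\<dots> = g (ept e c) * dird f (e, c, 1) + g (ept e d) * dird f (e, d, - 1)"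
      using * dir_deriv_poly[of c d f e P c 1] dir_deriv_poly[of c d f e P d "- 1"] P Q by simp
    finally show "(LBINT t:{c..d}. u (ept e t)) =
        g (ept e c) * dird f (e, c, 1) + g (ept e d) * dird f (e, d, - 1) + sum h (T \<inter> {c<..<d})"
      using * by (simp add: Int_commute)
  next
    fix c k d assume *: "0 \<le> c" "c < k" "k < d" "d \<le> L e" "k \<in> T"
      and 1: "(LBINT t:{c..k}. u (ept e t)) =
        g (ept e c) * dird f (e, c, 1) + g (ept e k) * dird f (e, k, - 1) + sum h (T \<inter> {c<..<k})"
      and 2: "(LBINT t:{k..d}. u (ept e t)) =
        g (ept e k) * dird f (e, k, 1) + g (ept e d) * dird f (e, d, - 1) + sum h (T \<inter> {k<..<d})"
    have "T \<inter> {c<..<d} = insert k (T \<inter> {c<..<k} \<union> T \<inter> {k<..<d})"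
      using * by auto
    then have "sum h (T \<inter> {c<..<d}) = h k + (sum h (T \<inter> {c<..<k}) + sum h (T \<inter> {k<..<d}))"
      using T by (subst sum.union_disjoint[symmetric]) auto
    moreover have "(LBINT t:{c..d}. u (ept e t)) = (LBINT t:{c..k}. u (ept e t)) + (LBINT t:{k..d}. u (ept e t))"
      using * by (intro set_integral_Icc_split set_integrable_subset[OF u_int]) auto
    ultimately show "(LBINT t:{c..d}. u (ept e t)) =
        g (ept e c) * dird f (e, c, 1) + g (ept e d) * dird f (e, d, - 1) + sum h (T \<inter> {c<..<d})"
      using 1 2 by (simp add: h_def algebra_simps)
  qed
  moreover have "T \<inter> {0<..<L e} = T" by (auto simp: T_def brk_def)
  ultimately show ?thesis by (simp add: u_def h_def T_def)
qed

text \<open>Double counting: the directions at vertices and points of \<open>S\<close> are, edge by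
  edge, one at each end and two at each break point.\<close>

lemma sum_directions_by_edges:
  assumes S: "finite S"
  shows "(\<Sum>x\<in>Vert ` V \<union> S. \<Sum>d\<in>dirs x. h d) =
    (\<Sum>e\<in>E. h (e, 0, 1) + h (e, L e, - 1) + (\<Sum>t\<in>brk S e. h (e, t, 1) + h (e, t, - 1)))"
proof -
  define W where "W e = {(0, 1), (L e, - 1)} \<union> brk S e \<times> {1, - 1 :: real}" for e
  have finW: "finite (W e)" for e using finite_brk[OF S] by (simp add: W_def)
  have U: "(\<Union>x\<in>Vert ` V \<union> S. dirs x) = Sigma E W"
  proof -
    have "d \<in> (\<Union>x\<in>Vert ` V \<union> S. dirs x) \<longleftrightarrow> d \<in> Sigma E W" for d
    proof -
      obtain e t s where d: "d = (e, t, s)" by (cases d)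
      have "d \<in> (\<Union>x\<in>Vert ` V \<union> S. dirs x) \<longleftrightarrow> e \<in> E \<and> 0 \<le> t \<and> t \<le> L e \<and>
          ept e t \<in> Vert ` V \<union> S \<and> (s = 1 \<and> t < L e \<or> s = - 1 \<and> 0 < t)"
        unfolding d directions_def by blast
      also have "\<dots> \<longleftrightarrow> e \<in> E \<and> (t, s) \<in> W e"
      proof (cases "e \<in> E")
        case True
        consider "t = 0" | "t = L e" | "0 < t" "t < L e" | "t < 0 \<or> L e < t" by linarith
        then show ?thesis
          using True len_pos[OF True]
          by cases (auto simp: W_def brk_def ept_inner)
      qed simp
      finally show ?thesis by (simp add: d)
    qed
    then show ?thesis by blast
  qed
  have fin: "finite (dirs x)" if "x \<in> Vert ` V \<union> S" for x
    by (rule finite_subset[of _ "Sigma E W"]) (use U that finW in auto)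
  \<comment> \<open>A direction determines its base point, so different points have disjoint sets of
    directions.\<close>
  have "(\<Sum>x\<in>Vert ` V \<union> S. \<Sum>d\<in>dirs x. h d) = sum h (\<Union>x\<in>Vert ` V \<union> S. dirs x)"
    by (rule sum.UNION_disjoint[symmetric]) (use S fin in \<open>auto simp: directions_def\<close>)
  also have "\<dots> = (\<Sum>e\<in>E. \<Sum>w\<in>W e. h (e, w))"
    unfolding U using finW by (subst sum.Sigma) auto
  also have "\<dots> = (\<Sum>e\<in>E. h (e, 0, 1) + h (e, L e, - 1) + (\<Sum>t\<in>brk S e. h (e, t, 1) + h (e, t, - 1)))"
  proof (rule sum.cong[OF refl])
    fix e assume e: "e \<in> E"
    have "(\<Sum>w\<in>W e. h (e, w)) =
        (\<Sum>w\<in>{(0, 1), (L e, - 1)}. h (e, w)) + (\<Sum>w\<in>brk S e \<times> {1, - 1}. h (e, w))"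
      unfolding W_def using finite_brk[OF S]
      by (intro sum.union_disjoint) (auto simp: brk_def)
    also have "(\<Sum>w\<in>brk S e \<times> {1, - 1}. h (e, w)) = (\<Sum>t\<in>brk S e. h (e, t, 1) + h (e, t, - 1))"
      by (simp add: sum.cartesian_product' )
    finally show "(\<Sum>w\<in>W e. h (e, w)) =
        h (e, 0, 1) + h (e, L e, - 1) + (\<Sum>t\<in>brk S e. h (e, t, 1) + h (e, t, - 1))"
      by simp
  qed
  finally show ?thesis .
qed

text \<open>When the edge identities are summed, the boundary terms regroup by points into the point
  masses of the Laplacian. The right-hand side is symmetric, so the Laplacian may be moved between
  \<open>f\<close> and \<open>g\<close>.\<close>

theorem Green_identity:
  assumes S: "finite S" "S \<subseteq> pts" and f: "pw_poly S n f" and g: "pw_poly S m g"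
  shows "integral_sm \<Gamma> g (laplacian \<Gamma> f) = Int_dx (\<lambda>x. dx f x * dx g x)"
proof -
  let ?S = "Vert ` V \<union> S"
  have "(\<lambda>s. f (ept e s)) differentiable at t" if "Inner e t \<in> pts - ?S" for e t
    using has_ddx[OF S(1) pw_poly_imp_inner[OF f], of e t] that
    by (auto simp: real_differentiable_def)
  then have "integral_sm \<Gamma> g (laplacian \<Gamma> f) = Int_dx (\<lambda>x. g x * - dx (dx f) x) -
      (\<Sum>x\<in>?S. g x * (\<Sum>d\<in>dirs x. dird f d))"
    using S by (intro integral_sm_laplacian) auto
  \<comment> \<open>Each direction recalls its base point, so the factor \<open>g x\<close> can be
    expressed through the direction.\<close>
  also have "(\<Sum>x\<in>?S. g x * (\<Sum>d\<in>dirs x. dird f d)) =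
      (\<Sum>x\<in>?S. \<Sum>d\<in>dirs x. g (ept (fst d) (fst (snd d))) * dird f d)"
    by (auto simp: sum_distrib_left directions_def intro!: sum.cong)
  also have "\<dots> = (\<Sum>e\<in>E. g (ept e 0) * dird f (e, 0, 1) + g (ept e (L e)) * dird f (e, L e, - 1) +
      (\<Sum>t\<in>brk S e. g (ept e t) * (dird f (e, t, 1) + dird f (e, t, - 1))))"
    by (subst sum_directions_by_edges[OF S(1)]) (simp add: algebra_simps)
  also have "\<dots> = Int_dx (\<lambda>x. g x * - dx (dx f) x - dx f x * dx g x)"
    unfolding integral_dx_def
    by (rule sum.cong[OF refl]) (rule Green_on_edge[OF S(1) f g, symmetric])
  also have "\<dots> = Int_dx (\<lambda>x. g x * - dx (dx f) x) - Int_dx (\<lambda>x. dx f x * dx g x)"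
  proof -
    have inner: "pw_poly_inner S f" "pw_poly_inner S g"
      using pw_poly_imp_inner f g by auto
    \<comment> \<open>The term \<open>0 * f x\<close> fits a single scaled function into the
      two-term rule.\<close>
    have "pw_poly_inner S (\<lambda>x. (- 1) * (g x * dx (dx f) x) + 0 * f x)"
      by (intro pw_poly_inner_lincomb pw_poly_inner_mult pw_poly_inner_ddx inner)
    then have "pw_poly_inner S (\<lambda>x. g x * - dx (dx f) x)" by simp
    moreover have "pw_poly_inner S (\<lambda>x. dx f x * dx g x)"
      by (intro pw_poly_inner_mult pw_poly_inner_ddx inner)
    ultimately show ?thesis
      using Int_dx_lincomb[OF S(1), of _ _ 1 "- 1"] by simp
  qed
  finally show ?thesis by simp
qed

section \<open>Piecewise affine functions and Dirichlet energy\<close>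

lemma ddx_ddx_affine:
  assumes "finite S" "pw_poly S 1 f" "Inner e t \<in> pts - S"
  shows "dx (dx f) (Inner e t) = 0"
proof -
  obtain a b where ab: "free S e a b" "a < t" "t < b"
    using free_around[OF assms(1,3)] .
  obtain P where P: "degree P \<le> 1" "\<And>t. t \<in> {a..b} \<Longrightarrow> f (ept e t) = poly P t"
    using pw_polyE[OF assms(2) ab(1)] by blast
  have "dx f (ept e s) = poly (pderiv P) s" if "s \<in> {a<..<b}" for s
    by (rule ddx_poly[of a b]) (use that P ab in \<open>auto simp: free_def\<close>)
  then have "dx (dx f) (ept e t) = poly (pderiv (pderiv P)) t"
    by (rule ddx_poly) (use ab in \<open>auto simp: free_def\<close>)
  moreover have "pderiv (pderiv P) = 0"
    using P(1) by (simp add: pderiv_eq_0_iff degree_pderiv)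
  ultimately show ?thesis
    using assms(3) by (simp add: ept_inner)
qed

text \<open>The second derivative vanishes off a null set, so only the point masses remain.\<close>

lemma integral_laplacian_affine:
  assumes "finite S" "pw_poly S 1 f"
  shows "integral_sm \<Gamma> g (laplacian \<Gamma> f) =
    (\<Sum>x | x \<in> pts \<and> (\<Sum>d\<in>dirs x. dird f d) \<noteq> 0. g x * - (\<Sum>d\<in>dirs x. dird f d))"
proof -
  have "Int_dx (\<lambda>x. g x * - dx (dx f) x) = Int_dx (\<lambda>x. 0)"
    by (rule Int_dx_cong[OF assms(1)]) (simp add: ddx_ddx_affine[OF assms])
  then show ?thesis
    by (simp add: integral_sm_def laplacian_def integral_dx_def)
qed

text \<open>On a segment the energy is its length times the squared slope, which is 0 only for slope
  0. Energies of adjoining segments are nonnegative, so they vanish separately.\<close>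

lemma zero_energy_constant_on_edge:
  assumes S: "finite S" and f: "pw_poly S 1 f" and e: "e \<in> E"
    and zero: "(LBINT t:{0..L e}. (dx f (ept e t))\<^sup>2) = 0"
  shows "\<forall>t\<in>{0..L e}. f (ept e t) = f (ept e 0)"
proof -
  have int: "set_integrable lborel {0..L e} (\<lambda>t. (dx f (ept e t))\<^sup>2)"
    unfolding power2_eq_square
    by (intro set_integrable_pw_poly[OF S _ e] pw_poly_inner_mult pw_poly_inner_ddx
        pw_poly_imp_inner[OF f])
  have nonneg: "0 \<le> (LBINT t:{c..d}. (dx f (ept e t))\<^sup>2)" for c d
    unfolding set_lebesgue_integral_def by (rule Bochner_Integration.integral_nonneg) (simp add: indicator_def)
  have "(LBINT t:{0..L e}. (dx f (ept e t))\<^sup>2) = 0 \<longrightarrow> (\<forall>t\<in>{0..L e}. f (ept e t) = f (ept e 0))"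
  proof (rule interval_partition_induct[OF finite_brk[OF S, of e] len_pos[OF e], where Q =
        "\<lambda>c d. (LBINT t:{c..d}. (dx f (ept e t))\<^sup>2) = 0 \<longrightarrow> (\<forall>t\<in>{c..d}. f (ept e t) = f (ept e c))"])
    fix c d assume *: "0 \<le> c" "c < d" "d \<le> L e" "{c<..<d} \<inter> brk S e = {}"
    then have free: "free S e c d" using e by (simp add: free_iff)
    obtain P where P: "degree P \<le> 1" "\<And>t. t \<in> {c..d} \<Longrightarrow> f (ept e t) = poly P t"
      using pw_polyE[OF f free] by blast
    define p1 where "p1 = coeff P 1"
    have p: "P = [:coeff P 0, p1:]"
      using P(1) by (auto intro!: poly_eqI simp: p1_def coeff_pCons coeff_eq_0 split: nat.split)
    have P': "f (ept e t) = coeff P 0 + t * p1" if "t \<in> {c..d}" for t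
      using P(2)[OF that] by (subst (asm) p) simp
    have dP: "dx f (ept e t) = p1" if "t \<in> {c<..<d}" for t
      using that * by (subst ddx_poly[of c d f e "[:coeff P 0, p1:]"]) (auto simp: P' pderiv_pCons)
    \<comment> \<open>The constant integrand is written as the derivative of a linear polynomial, to
      be integrated by \<open>set_integral_poly_pderiv\<close>.\<close>
    have "(LBINT t:{c..d}. (dx f (ept e t))\<^sup>2) = (LBINT t:{c..d}. poly (pderiv [:0, p1\<^sup>2:]) t)"
      by (rule set_integral_cong_countable[where X = "{c, d}"])
        (auto simp: dP pderiv_pCons)
    also have "\<dots> = (d - c) * p1\<^sup>2"
      using * by (subst set_integral_poly_pderiv) (auto simp: algebra_simps)
    finally show "(LBINT t:{c..d}. (dx f (ept e t))\<^sup>2) = 0 \<longrightarrow> (\<forall>t\<in>{c..d}. f (ept e t) = f (ept e c))"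
      using * by (auto simp: P')
  next
    fix c k d assume *: "0 \<le> c" "c < k" "k < d" "d \<le> L e" "k \<in> brk S e"
      and 1: "(LBINT t:{c..k}. (dx f (ept e t))\<^sup>2) = 0 \<longrightarrow> (\<forall>t\<in>{c..k}. f (ept e t) = f (ept e c))"
      and 2: "(LBINT t:{k..d}. (dx f (ept e t))\<^sup>2) = 0 \<longrightarrow> (\<forall>t\<in>{k..d}. f (ept e t) = f (ept e k))"
    have "(LBINT t:{c..d}. (dx f (ept e t))\<^sup>2) =
        (LBINT t:{c..k}. (dx f (ept e t))\<^sup>2) + (LBINT t:{k..d}. (dx f (ept e t))\<^sup>2)"
      using * by (intro set_integral_Icc_split set_integrable_subset[OF int]) auto
    moreover have "{c..d} = {c..k} \<union> {k..d}" using * by auto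
    ultimately show "(LBINT t:{c..d}. (dx f (ept e t))\<^sup>2) = 0 \<longrightarrow> (\<forall>t\<in>{c..d}. f (ept e t) = f (ept e c))"
      using 1 2 nonneg[of c k] nonneg[of k d] *
      by (smt (verit, best) Un_iff atLeastAtMost_iff)
  qed
  with zero show ?thesis by simp
qed

text \<open>Green's identity with \<open>g = f\<close> turns zero net current into zero energy. So
  \<open>f\<close> is constant on each edge, and connectedness does the rest.\<close>

lemma harmonic_constant:
  assumes S: "finite S" "S \<subseteq> pts" and f: "pw_poly S 1 f"
    and harmonic: "\<And>x. x \<in> pts \<Longrightarrow> (\<Sum>d\<in>dirs x. dird f d) = 0"
    and "x \<in> pts" "y \<in> pts"
  shows "f x = f y"
proof -
  have "integral_sm \<Gamma> f (laplacian \<Gamma> f) = 0"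
    by (subst integral_laplacian_affine[OF S(1) f]) (use harmonic in auto)
  then have "Int_dx (\<lambda>x. (dx f x)\<^sup>2) = 0"
    by (simp add: Green_identity[OF S f f] power2_eq_square)
  then have "\<forall>e\<in>E. (LBINT t:{0..L e}. (dx f (ept e t))\<^sup>2) = 0"
    unfolding integral_dx_def
    by (subst (asm) sum_nonneg_eq_0_iff)
      (auto simp: set_lebesgue_integral_def indicator_def intro!: Bochner_Integration.integral_nonneg)
  then have edge: "f (ept e t) = f (Vert (src e))" if "e \<in> E" "0 \<le> t" "t \<le> L e" for e t
    using zero_energy_constant_on_edge[OF S(1) f that(1)] that by auto
  have vert: "f (Vert u) = f (Vert v)" if "u \<in> V" "v \<in> V" for u v
  proof (rule constant_on_vertices[of "\<lambda>v. f (Vert v)", OF _ that])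
    fix e assume "e \<in> E"
    then show "f (Vert (src e)) = f (Vert (tgt e))"
      using edge[of e "L e"] len_pos[of e] by simp
  qed
  have "\<exists>v\<in>V. f x = f (Vert v)" if "x \<in> pts" for x
  proof (cases x)
    case (Inner e t)
    then show ?thesis using that edge[of e t] by (auto simp: ept_inner)
  qed (use that in auto)
  then show ?thesis
    using assms(5,6) vert by metis
qed

subsection \<open>Uniqueness of potentials\<close>

text \<open>A constant current \<open>i\<close> is the same as an affine function of slope
  \<open>- i\<close>, so the first clause of \<open>is_potential\<close> becomes a degree
  bound.\<close>

lemma ohm_iff_pw_poly:
  "(\<forall>e\<in>E. \<forall>a b. 0 \<le> a \<and> a < b \<and> b \<le> L e \<and> ept e ` {a<..<b} \<inter> S = {} \<longrightarrow>
     (\<exists>i. \<forall>t\<in>{a..b}. f (ept e a) - f (ept e t) = i * (t - a))) \<longleftrightarrow> pw_poly S 1 f"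
  (is "?ohm \<longleftrightarrow> _")
proof
  assume ohm: ?ohm
  show "pw_poly S 1 f"
  proof (rule pw_polyI)
    fix e a b assume "free S e a b"
    then have "\<exists>i. \<forall>t\<in>{a..b}. f (ept e a) - f (ept e t) = i * (t - a)"
      by (intro ohm[THEN bspec, THEN spec, THEN spec, THEN mp]) (simp_all add: free_def)
    then obtain i where i: "\<forall>t\<in>{a..b}. f (ept e a) - f (ept e t) = i * (t - a)" ..
    show "\<exists>P. degree P \<le> 1 \<and> (\<forall>t\<in>{a..b}. f (ept e t) = poly P t)"
    proof (intro exI[of _ "[:f (ept e a) + i * a, - i:]"] conjI ballI)
      fix t assume "t \<in> {a..b}"
      with i have "f (ept e a) - f (ept e t) = i * (t - a)" by blast
      then show "f (ept e t) = poly [:f (ept e a) + i * a, - i:] t"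
        by (simp add: algebra_simps)
    qed simp
  qed
next
  assume f: "pw_poly S 1 f"
  show ?ohm
  proof (intro ballI allI impI)
    fix e a b assume "e \<in> E" and *: "0 \<le> a \<and> a < b \<and> b \<le> L e \<and> ept e ` {a<..<b} \<inter> S = {}"
    then have "free S e a b" by (simp add: free_def)
    from pw_polyE[OF f this] obtain P
      where P: "degree P \<le> 1" "\<And>t. t \<in> {a..b} \<Longrightarrow> f (ept e t) = poly P t" by blast
    have p: "P = [:coeff P 0, coeff P 1:]"
      using P(1) by (auto intro!: poly_eqI simp: coeff_pCons coeff_eq_0 split: nat.split)
    have P': "f (ept e t) = coeff P 0 + t * coeff P 1" if "t \<in> {a..b}" for t
      using P(2)[OF that] by (subst (asm) p) simp
    show "\<exists>i. \<forall>t\<in>{a..b}. f (ept e a) - f (ept e t) = i * (t - a)"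
      using * by (intro exI[of _ "- coeff P 1"]) (auto simp: P' algebra_simps)
  qed
qed

text \<open>The net current leaving \<open>x\<close> along the circuit, which is also the point mass
  at \<open>x\<close> of the Laplacian of \<open>f\<close>.\<close>

definition flux :: "(('v, 'e) pt \<Rightarrow> real) \<Rightarrow> ('v, 'e) pt \<Rightarrow> real" where
  "flux f x = (\<Sum>d\<in>dirs x. - dird f d)"

lemma is_potential_iff:
  "is_potential \<Gamma> y z f \<longleftrightarrow> pw_poly {y, z} 1 f \<and>
     (\<forall>x\<in>pts. flux f x = of_bool (x = y) - of_bool (x = z)) \<and> f z = 0"
  unfolding is_potential_def ohm_iff_pw_poly flux_def ..

lemma flux_lincomb:
  assumes "finite S" "pw_poly S n f" "pw_poly S m g"
  shows "flux (\<lambda>x. a * f x + b * g x) x = a * flux f x + b * flux g x"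
proof -
  have "flux (\<lambda>x. a * f x + b * g x) x = (\<Sum>d\<in>dirs x. a * - dird f d + b * - dird g d)"
    unfolding flux_def by (rule sum.cong) (simp_all add: dir_deriv_lincomb[OF assms])
  then show ?thesis
    by (simp only: flux_def sum.distrib sum_distrib_left)
qed

lemma flux_const: "flux (\<lambda>x. c) x = 0"
  by (auto simp: flux_def dir_deriv_def tendsto_Lim intro!: sum.neutral)

lemma flux_cong: "(\<And>x. x \<in> pts \<Longrightarrow> f x = g x) \<Longrightarrow> flux f x = flux g x"
  unfolding flux_def by (intro sum.cong refl arg_cong[where f = uminus] dir_deriv_cong)

lemma is_potential_cong:
  assumes "\<And>x. x \<in> pts \<Longrightarrow> f x = g x" "z \<in> pts" "is_potential \<Gamma> y z f"
  shows "is_potential \<Gamma> y z g"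
  using assms pw_poly_cong[of f g] flux_cong[of f g] by (auto simp: is_potential_iff)

text \<open>The difference of two potentials has no net current anywhere, hence is constant, and it
  vanishes at the grounded point.\<close>

lemma potential_unique:
  assumes f: "is_potential \<Gamma> y z f" and g: "is_potential \<Gamma> y z g"
    and pts: "y \<in> pts" "z \<in> pts" "x \<in> pts"
  shows "f x = g x"
proof -
  have pw: "pw_poly {y, z} 1 f" "pw_poly {y, z} 1 g"
    using f g by (auto simp: is_potential_iff)
  have "1 * f x + - 1 * g x = 1 * f z + - 1 * g z"
  proof (rule harmonic_constant[of "{y, z}" "\<lambda>x. 1 * f x + - 1 * g x"])
    fix x assume "x \<in> pts"
    then have "flux (\<lambda>x. 1 * f x + - 1 * g x) x = 0"
      using f g by (subst flux_lincomb[OF _ pw]) (auto simp: is_potential_iff)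
    then show "(\<Sum>d\<in>dirs x. dird (\<lambda>x. 1 * f x + - 1 * g x) d) = 0"
      by (simp add: flux_def sum_negf)
  next
    show "pw_poly {y, z} 1 (\<lambda>x. 1 * f x + - 1 * g x)"
      by (rule pw_poly_lincomb[OF pw])
  qed (use pts in auto)
  then show ?thesis
    using f g by (simp add: is_potential_iff)
qed

text \<open>All potentials agree at \<open>x\<close>, so the definite description in
  \<open>jf\<close> is met by any one of them.\<close>

lemma jf_eq:
  assumes "is_potential \<Gamma> y z f" "y \<in> pts" "z \<in> pts" "x \<in> pts"
  shows "jf \<Gamma> z x y = f x"
  unfolding jf_def
  by (rule the_equality) (use assms potential_unique in blast)+

subsection \<open>Existence of potentials\<close>

text \<open>The combinatorial Laplacian with conductance \<open>1 / L e\<close> on each edge; loops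
  contribute 0.\<close>

definition vlap :: "('v \<Rightarrow> real) \<Rightarrow> 'v \<Rightarrow> real" where
  "vlap h v = (\<Sum>e\<in>E. (of_bool (src e = v) - of_bool (tgt e = v)) * ((h (src e) - h (tgt e)) / L e))"

lemma sum_of_bool_mult:
  assumes "w \<in> V"
  shows "(\<Sum>v\<in>V. of_bool (v = w) * h v) = (h w :: real)"
  using assms by (subst sum.remove[of V w]) auto

lemma sum_incidence:
  assumes "e \<in> E"
  shows "(\<Sum>v\<in>V. h v * (of_bool (src e = v) - of_bool (tgt e = v))) = (h (src e) - h (tgt e) :: real)"
  using assms sum_of_bool_mult[of "src e" h] sum_of_bool_mult[of "tgt e" h]
  by (simp add: right_diff_distrib sum_subtractf mult.commute eq_commute)

text \<open>Summation by parts: after exchanging the sums, each edge retains the difference of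
  \<open>k\<close> between its ends.\<close>

lemma vlap_pairing:
  "(\<Sum>v\<in>V. k v * vlap h v) = (\<Sum>e\<in>E. (k (src e) - k (tgt e)) * ((h (src e) - h (tgt e)) / L e))"
proof -
  have "(\<Sum>v\<in>V. k v * vlap h v) = (\<Sum>e\<in>E. \<Sum>v\<in>V. k v * (of_bool (src e = v) - of_bool (tgt e = v)) *
      ((h (src e) - h (tgt e)) / L e))"
    unfolding vlap_def sum_distrib_left by (subst sum.swap) (simp add: mult.assoc)
  also have "\<dots> = (\<Sum>e\<in>E. (\<Sum>v\<in>V. k v * (of_bool (src e = v) - of_bool (tgt e = v))) *
      ((h (src e) - h (tgt e)) / L e))"
    by (simp only: sum_distrib_right)
  finally show ?thesis
    by (simp add: sum_incidence)
qed

text \<open>Pairing \<open>h\<close> with itself gives a vanishing sum of nonnegative terms, one per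
  edge, so every difference along an edge is 0.\<close>

lemma vlap_zero_constant:
  assumes "\<And>v. v \<in> V \<Longrightarrow> vlap h v = 0" "u \<in> V" "v \<in> V"
  shows "h u = h v"
proof (rule constant_on_vertices[OF _ assms(2,3)])
  have "(\<Sum>e\<in>E. (h (src e) - h (tgt e)) * ((h (src e) - h (tgt e)) / L e)) = 0"
    unfolding vlap_pairing[symmetric] using assms(1) by simp
  moreover have "0 \<le> (h (src e) - h (tgt e)) * ((h (src e) - h (tgt e)) / L e)" if "e \<in> E" for e
    using len_pos[OF that] by simp
  ultimately have "\<forall>e\<in>E. (h (src e) - h (tgt e)) * ((h (src e) - h (tgt e)) / L e) = 0"
    by (subst (asm) sum_nonneg_eq_0_iff) auto
  then show "h (src e) = h (tgt e)" if "e \<in> E" for e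
    using that len_pos[OF that] by auto
qed

text \<open>Constants lie in the kernel of \<open>vlap\<close>, so a unit entry is added at
  \<open>(z, z)\<close>. As \<open>vlap h\<close> has total 0, summing the equations isolates
  \<open>h z\<close>. This gives injectivity, and later shows that the solution also solves the
  system without the extra entry.\<close>

lemma vertex_potential_exists:
  assumes "u \<in> V" "z \<in> V"
  shows "\<exists>h. \<forall>v\<in>V. vlap h v = of_bool (v = u) - of_bool (v = z)"
proof -
  define A where "A v w = (\<Sum>e\<in>E. (of_bool (src e = v) - of_bool (tgt e = v)) / L e *
      (of_bool (src e = w) - of_bool (tgt e = w))) + of_bool (v = z) * of_bool (w = z)" for v w
  have A: "(\<Sum>w\<in>V. A v w * h w) = vlap h v + of_bool (v = z) * h z" for h v
  proof -
    have "(\<Sum>w\<in>V. A v w * h w) =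
        (\<Sum>w\<in>V. \<Sum>e\<in>E. (of_bool (src e = v) - of_bool (tgt e = v)) / L e *
          (h w * (of_bool (src e = w) - of_bool (tgt e = w)))) +
        (\<Sum>w\<in>V. of_bool (v = z) * of_bool (w = z) * h w)"
      by (simp only: A_def distrib_left distrib_right sum_distrib_left sum_distrib_right sum.distrib mult_ac)
    also have "(\<Sum>w\<in>V. \<Sum>e\<in>E. (of_bool (src e = v) - of_bool (tgt e = v)) / L e *
          (h w * (of_bool (src e = w) - of_bool (tgt e = w)))) =
        (\<Sum>e\<in>E. (of_bool (src e = v) - of_bool (tgt e = v)) / L e *
          (\<Sum>w\<in>V. h w * (of_bool (src e = w) - of_bool (tgt e = w))))"
      by (subst sum.swap) (simp only: sum_distrib_left)
    also have "\<dots> = vlap h v"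
      by (simp add: vlap_def sum_incidence)
    also have "(\<Sum>w\<in>V. of_bool (v = z) * of_bool (w = z) * h w) = of_bool (v = z) * h z"
      using sum_of_bool_mult[OF assms(2), of h] by (simp add: mult.assoc flip: sum_distrib_left)
    finally show ?thesis .
  qed
  have sum0: "(\<Sum>v\<in>V. vlap h v) = 0" for h
    using vlap_pairing[of "\<lambda>_. 1" h] by simp
  have sumA: "(\<Sum>v\<in>V. vlap h v + of_bool (v = z) * h z) = h z" for h
    using sum_of_bool_mult[OF assms(2), of "\<lambda>_. h z"] sum0 by (simp add: sum.distrib)
  have "\<forall>v\<in>V. h v = 0" if "\<forall>v\<in>V. (\<Sum>w\<in>V. A v w * h w) = 0" for h
  proof -
    have *: "vlap h v + of_bool (v = z) * h z = 0" if "v \<in> V" for v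
      using that \<open>\<forall>v\<in>V. (\<Sum>w\<in>V. A v w * h w) = 0\<close> A by simp
    then have "h z = 0"
      using sumA[of h] by simp
    with * have "vlap h v = 0" if "v \<in> V" for v
      using that by force
    then show ?thesis
      using vlap_zero_constant[of h] \<open>h z = 0\<close> assms(2) by metis
  qed
  then have "\<exists>h. \<forall>v\<in>V. (\<Sum>w\<in>V. A v w * h w) = of_bool (v = u) - of_bool (v = z)"
    by (rule injective_square_system_solvable[OF finite_verts])
  then obtain h where h: "\<forall>v\<in>V. (\<Sum>w\<in>V. A v w * h w) = of_bool (v = u) - of_bool (v = z)" ..
  then have *: "vlap h v + of_bool (v = z) * h z = of_bool (v = u) - of_bool (v = z)" if "v \<in> V" for v
    using that A by simp
  \<comment> \<open>The right-hand side has total 0, so \<open>h z = 0\<close> and the added entry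
    drops out.\<close>
  have "h z = (\<Sum>v\<in>V. of_bool (v = u) - of_bool (v = z))"
    using sumA[of h] by (simp add: *)
  also have "\<dots> = 0"
    using sum_of_bool_mult[of _ "\<lambda>_. 1"] assms by (simp add: sum_subtractf)
  finally have "h z = 0" .
  then have "\<forall>v\<in>V. vlap h v = of_bool (v = u) - of_bool (v = z)"
    using * by force
  then show ?thesis by (rule exI[of _ h])
qed

section \<open>Linear interpolation of vertex values along edges\<close>

definition ext :: "('v \<Rightarrow> real) \<Rightarrow> ('v, 'e) pt \<Rightarrow> real" where
  "ext h x = (case x of Vert v \<Rightarrow> h v | Inner e t \<Rightarrow> h (src e) + t / L e * (h (tgt e) - h (src e)))"

lemma ext_ept: "e \<in> E \<Longrightarrow> ext h (ept e t) = h (src e) + t / L e * (h (tgt e) - h (src e))"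
  using len_pos[of e] by (simp add: ext_def edge_pt_def)

lemma ext_cong: "x \<in> pts \<Longrightarrow> (\<And>v. v \<in> V \<Longrightarrow> h v = k v) \<Longrightarrow> ext h x = ext k x"
  by (auto simp: ext_def split: pt.split)

text \<open>Both sides are the bilinear interpolation of \<open>g\<close>.\<close>

lemma ext_swap: "ext (\<lambda>v. ext (\<lambda>u. g u v) y) x = ext (\<lambda>u. ext (g u) x) y"
  by (cases x; cases y) (simp_all add: ext_def algebra_simps)

lemma ext_ept_poly:
  "e \<in> E \<Longrightarrow> ext h (ept e t) = poly [:h (src e), (h (tgt e) - h (src e)) / L e:] t"
  by (simp add: ext_ept)

lemma pw_poly_ext: "pw_poly S 1 (ext h)"
  by (rule pw_polyI, rule exI[of _ "[:h (src _), (h (tgt _) - h (src _)) / L _:]"])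
    (auto simp: ext_ept free_def)

text \<open>With both variables at the same point of an edge, two affine dependences on
  \<open>t\<close> multiply to degree 2.\<close>

lemma pw_poly_ext_diagonal: "pw_poly S 2 (\<lambda>x. ext (\<lambda>v. ext (\<lambda>u. g u v) x) x)"
proof (rule pw_polyI)
  fix e a b assume "free S e a b"
  then have e: "e \<in> E" by (simp add: free_def)
  \<comment> \<open>The mixed second difference of \<open>g\<close> over the edge, which is the
    coefficient of the square of \<open>t / L e\<close>.\<close>
  define c where "c = g (tgt e) (tgt e) - g (tgt e) (src e) - g (src e) (tgt e) + g (src e) (src e)"
  show "\<exists>P. degree P \<le> 2 \<and> (\<forall>t\<in>{a..b}. ext (\<lambda>v. ext (\<lambda>u. g u v) (ept e t)) (ept e t) = poly P t)"
    by (rule exI[of _ "[:g (src e) (src e),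
        (g (tgt e) (src e) + g (src e) (tgt e) - 2 * g (src e) (src e)) / L e, c / (L e)\<^sup>2:]"])
      (use len_pos[OF e] in \<open>simp add: ext_ept[OF e] c_def field_simps power2_eq_square\<close>)
qed

section \<open>Net currents of interpolated functions and tent functions\<close>

lemma flux_Vert:
  "flux f (Vert v) =
    - (\<Sum>e\<in>E. of_bool (src e = v) * dird f (e, 0, 1) + of_bool (tgt e = v) * dird f (e, L e, - 1))"
proof -
  let ?A = "(\<lambda>e. (e, 0, 1)) ` {e \<in> E. src e = v}" and ?B = "(\<lambda>e. (e, L e, - 1)) ` {e \<in> E. tgt e = v}"
  \<comment> \<open>A loop at \<open>v\<close> enters both sets, with two different
    directions.\<close>
  have dirs: "dirs (Vert v) = ?A \<union> ?B"
    by (auto simp: directions_def edge_pt_def less_imp_le len_pos split: if_splits)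
      (use len_pos in force)
  have filt: "sum k {e \<in> E. Q e} = (\<Sum>e\<in>E. of_bool (Q e) * k e)" for k :: "'e \<Rightarrow> real" and Q
    by (rule sum.mono_neutral_cong_left) auto
  have "(\<Sum>d\<in>dirs (Vert v). dird f d) = sum (dird f) ?A + sum (dird f) ?B"
    unfolding dirs by (rule sum.union_disjoint) auto
  also have "sum (dird f) ?A = (\<Sum>e\<in>E. of_bool (src e = v) * dird f (e, 0, 1))"
    by (subst sum.reindex) (simp_all add: inj_on_def filt)
  also have "sum (dird f) ?B = (\<Sum>e\<in>E. of_bool (tgt e = v) * dird f (e, L e, - 1))"
    by (subst sum.reindex) (simp_all add: inj_on_def filt)
  finally show ?thesis
    by (simp add: flux_def sum_negf sum.distrib)
qed

lemma flux_Inner: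
  assumes "Inner e t \<in> pts"
  shows "flux f (Inner e t) = - dird f (e, t, 1) - dird f (e, t, - 1)"
  using assms by (simp add: flux_def directions_Inner)

text \<open>The slope along an edge is constant: at an inner point the two directions cancel, and at
  a vertex the slopes add up to \<open>vlap\<close>.\<close>

lemma flux_ext:
  assumes "x \<in> pts"
  shows "flux (ext h) x = (case x of Vert v \<Rightarrow> vlap h v | Inner e t \<Rightarrow> 0)"
proof -
  have d: "dird (ext h) (e, t, s) = s * ((h (tgt e) - h (src e)) / L e)"
    if "e \<in> E" "t \<in> {0..L e}" "s = 1 \<and> t < L e \<or> s = - 1 \<and> 0 < t" for e t s
    by (subst dir_deriv_poly[OF ext_ept_poly[OF that(1)] that(2,3)]) (simp add: pderiv_pCons)
  show ?thesis
  proof (cases x)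
    case (Vert v)
    have "flux (ext h) (Vert v) = - (\<Sum>e\<in>E. of_bool (src e = v) * ((h (tgt e) - h (src e)) / L e) +
        of_bool (tgt e = v) * (- 1 * ((h (tgt e) - h (src e)) / L e)))"
      unfolding flux_Vert
      by (intro arg_cong[where f = uminus] sum.cong refl) (use len_pos in \<open>simp add: d less_imp_le\<close>)
    also have "\<dots> = vlap h v"
      unfolding vlap_def sum_negf[symmetric]
      by (rule sum.cong) (auto simp: diff_divide_distrib)
    finally show ?thesis by (simp add: Vert)
  next
    case (Inner e t)
    then show ?thesis using assms by (simp add: flux_Inner d diff_divide_distrib)
  qed
qed

text \<open>
  For a source \<open>y\<close> inside an edge, \<open>hat y\<close> is the potential on that edge with unit current
  entering at \<open>y\<close> and both ends grounded.
\<close>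

definition hat :: "('v, 'e) pt \<Rightarrow> ('v, 'e) pt \<Rightarrow> real" where
  "hat y x = (case y of Inner e s \<Rightarrow>
     (case x of Inner e' t \<Rightarrow> if e = e' then min s t - s * t / L e else 0 | _ \<Rightarrow> 0) | _ \<Rightarrow> 0)"

text \<open>This symmetry lets \<open>green\<close> be read as a function of its source.\<close>

lemma hat_commute: "hat y x = hat x y"
  by (auto simp: hat_def min.commute split: pt.split)

lemma hat_ept:
  assumes "Inner e s \<in> pts" "e' \<in> E" "0 \<le> t" "t \<le> L e'"
  shows "hat (Inner e s) (ept e' t) = (if e = e' then min s t - s * t / L e else 0)"
  using assms by (auto simp: hat_def edge_pt_def)

lemma hat_poly:
  assumes "Inner e s \<in> pts"
  shows "t \<in> {0..s} \<Longrightarrow> hat (Inner e s) (ept e t) = poly [:0, 1 - s / L e:] t"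
    and "t \<in> {s..L e} \<Longrightarrow> hat (Inner e s) (ept e t) = poly [:s, - s / L e:] t"
    and "e' \<in> E \<Longrightarrow> e' \<noteq> e \<Longrightarrow> t \<in> {0..L e'} \<Longrightarrow> hat (Inner e s) (ept e' t) = poly 0 t"
  using assms by (auto simp: hat_ept field_simps)

lemma pw_poly_hat:
  assumes "y \<in> pts"
  shows "pw_poly {y} 1 (hat y)"
proof (cases y)
  case (Vert v)
  then show ?thesis using pw_poly_const[of _ _ 0] by (simp add: hat_def[abs_def])
next
  case (Inner e s)
  show ?thesis
  proof (rule pw_polyI)
    fix e' a b assume free: "free {y} e' a b"
    show "\<exists>P. degree P \<le> 1 \<and> (\<forall>t\<in>{a..b}. hat y (ept e' t) = poly P t)"
    proof (cases "e' = e")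
      case True
      have "s \<notin> {a<..<b}"
        using free assms Inner True by (auto simp: free_iff brk_def)
      then consider "b \<le> s" | "s \<le> a" by fastforce
      then show ?thesis
      proof cases
        case 1
        then show ?thesis
          using hat_poly(1)[of e s] free assms unfolding Inner True
          by (intro exI[of _ "[:0, 1 - s / L e:]"]) (auto simp: free_def)
      next
        case 2
        then show ?thesis
          using hat_poly(2)[of e s] free assms unfolding Inner True
          by (intro exI[of _ "[:s, - s / L e:]"]) (auto simp: free_def)
      qed
    next
      case False
      then show ?thesis
        using hat_poly(3)[of e s e'] free assms unfolding Inner
        by (intro exI[of _ 0]) (auto simp: free_def)
    qed
  qed
qed

lemma pw_poly_hat_diagonal: "pw_poly S 2 (\<lambda>x. hat x x)"
proof (rule pw_polyI)
  fix e a b assume "free S e a b"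
  \<comment> \<open>On the diagonal the tent has height \<open>t - t^2 / L e\<close>: the kink
    disappears, and the value at both ends is 0, as at vertices.\<close>
  then show "\<exists>P. degree P \<le> 2 \<and> (\<forall>t\<in>{a..b}. hat (ept e t) (ept e t) = poly P t)"
    using len_pos[of e]
    by (intro exI[of _ "[:0, 1, - 1 / L e:]"]) (auto simp: free_def hat_def edge_pt_def field_simps)
qed

text \<open>For \<open>y\<close> at parameter \<open>s\<close> the current exits at the tail with
  share \<open>1 - s / L e\<close> and at the head with share \<open>s / L e\<close>. These are the
  interpolation weights, so the amount exiting at \<open>v\<close> is the interpolated indicator of
  \<open>v\<close>. For a vertex \<open>y\<close> the tent is 0 and the two terms cancel.\<close>

lemma flux_hat:
  assumes y: "y \<in> pts" and x: "x \<in> pts"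
  shows "flux (hat y) x = of_bool (x = y) -
    (case x of Vert v \<Rightarrow> ext (\<lambda>u. of_bool (u = v)) y | Inner e t \<Rightarrow> 0)"
proof (cases y)
  case (Vert w)
  then have "flux (hat y) x = 0"
    using flux_const[of 0 x] by (simp add: hat_def[abs_def])
  then show ?thesis
    by (auto simp: Vert ext_def split: pt.split)
next
  case (Inner e s)
  with y have s: "e \<in> E" "0 < s" "s < L e" and y': "Inner e s \<in> pts" by auto
  have dl: "dird (hat y) (e, t, r) = r * (1 - s / L e)"
    if "t \<in> {0..s}" "r = 1 \<and> t < s \<or> r = - 1 \<and> 0 < t" for t r
    by (subst dir_deriv_poly[of 0 s _ _ "[:0, 1 - s / L e:]", OF _ that]) (auto simp: Inner hat_poly(1)[OF y'] pderiv_pCons)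
  have dr: "dird (hat y) (e, t, r) = r * (- s / L e)"
    if "t \<in> {s..L e}" "r = 1 \<and> t < L e \<or> r = - 1 \<and> s < t" for t r
    by (subst dir_deriv_poly[of s "L e" _ _ "[:s, - s / L e:]", OF _ that]) (auto simp: Inner hat_poly(2)[OF y'] pderiv_pCons)
  have d0: "dird (hat y) (e', t, r) = 0"
    if "e' \<in> E" "e' \<noteq> e" "t \<in> {0..L e'}" "r = 1 \<and> t < L e' \<or> r = - 1 \<and> 0 < t" for e' t r
    by (subst dir_deriv_poly[of 0 "L e'" _ _ 0, OF _ that(3,4)]) (auto simp: Inner hat_poly(3)[OF y' that(1,2)])
  show ?thesis
  proof (cases x)
    case (Vert v)
    have "flux (hat y) x = - (\<Sum>e'\<in>E. if e' = e then of_bool (src e = v) * (1 - s / L e) +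
        of_bool (tgt e = v) * (s / L e) else 0)"
      unfolding flux_Vert Vert
    proof (intro arg_cong[where f = uminus] sum.cong refl)
      fix e' assume "e' \<in> E"
      then show "of_bool (src e' = v) * dird (hat y) (e', 0, 1) + of_bool (tgt e' = v) * dird (hat y) (e', L e', - 1) =
          (if e' = e then of_bool (src e = v) * (1 - s / L e) + of_bool (tgt e = v) * (s / L e) else 0)"
        using s len_pos[of e'] by (cases "e' = e") (simp_all add: dl dr d0)
    qed
    also have "\<dots> = - ext (\<lambda>u. of_bool (u = v)) y"
      using s by (simp add: Inner ext_def algebra_simps)
    finally show ?thesis by (simp add: Vert Inner)
  next
    case x': (Inner e' t)
    consider "e' \<noteq> e" | "e' = e" "t < s" | "e' = e" "t = s" | "e' = e" "s < t" by force
    then show ?thesis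
      by cases (use x s in \<open>simp_all add: x' flux_Inner dl[unfolded Inner] dr[unfolded Inner] d0[unfolded Inner] Inner\<close>)
  qed
qed

section \<open>A Green function with a common sink\<close>

lemma vlap_ext: "vlap (\<lambda>v. ext (\<lambda>u. g u v) y) w = ext (\<lambda>u. vlap (g u) w) y"
proof (cases y)
  case (Inner e s)
  have "vlap (\<lambda>v. h v + c * (k v - h v)) w = vlap h w + c * (vlap k w - vlap h w)" for h k c
    unfolding vlap_def sum_distrib_left sum_subtractf[symmetric] sum.distrib[symmetric]
    by (rule sum.cong) (auto simp: algebra_simps diff_divide_distrib add_divide_distrib)
  then show ?thesis unfolding Inner ext_def pt.case by blast
qed (simp add: ext_def)

text \<open>Vertex potentials interpolated in source and position; the tent supplies the kink at a
  source inside an edge.\<close>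

definition green :: "('v \<Rightarrow> 'v \<Rightarrow> real) \<Rightarrow> ('v, 'e) pt \<Rightarrow> ('v, 'e) pt \<Rightarrow> real" where
  "green g y x = ext (\<lambda>v. ext (\<lambda>u. g u v) y) x + hat y x"

lemma pw_poly_green: "y \<in> pts \<Longrightarrow> pw_poly {y} 1 (green g y)"
  unfolding green_def[abs_def] by (intro pw_poly_add pw_poly_ext pw_poly_hat)

text \<open>In \<open>jf \<Gamma> x p q\<close> the variable is the exit point, so the dependence on
  the first slot matters too. Exchanging the interpolations and the arguments of \<open>hat\<close>
  reduces it to the dependence on position.\<close>

lemma pw_poly_green_left:
  assumes "x \<in> pts"
  shows "pw_poly {x} 1 (\<lambda>y. green g y x)"
proof -
  have "green g y x = ext (\<lambda>u. ext (g u) x) y + hat x y" for y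
    unfolding green_def by (subst ext_swap, simp only: hat_commute[of y x])
  then show ?thesis
    by (simp only:) (intro pw_poly_add pw_poly_ext pw_poly_hat assms)
qed

lemma pw_poly_green_diagonal: "pw_poly S 2 (\<lambda>x. green g x x)"
  unfolding green_def[abs_def] by (intro pw_poly_add pw_poly_ext_diagonal pw_poly_hat_diagonal)

text \<open>All sources share one sink. The current that \<open>hat y\<close> lets out at the ends
  of its edge is fed back in, with the same weights, by the interpolated vertex potentials.\<close>

lemma green_exists:
  obtains z g where "\<forall>x\<in>pts. \<forall>y\<in>pts. flux (green g y) x = of_bool (x = y) - of_bool (x = z)"
proof -
  obtain z where z: "z \<in> V"
    using metrized_graph
    by (auto simp: metrized_graph_def Digraph_Component.connected_def strongly_connected_def)
  have "\<forall>u\<in>V. \<exists>h. \<forall>v\<in>V. vlap h v = of_bool (v = u) - of_bool (v = z)"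
    using vertex_potential_exists z by blast
  then obtain g where g: "\<And>u v. u \<in> V \<Longrightarrow> v \<in> V \<Longrightarrow> vlap (g u) v = of_bool (v = u) - of_bool (v = z)"
    by metis
  show ?thesis
  proof (rule that[of g "Vert z"], intro ballI)
    fix x y assume x: "x \<in> pts" and y: "y \<in> pts"
    have "flux (green g y) x = flux (\<lambda>x. 1 * ext (\<lambda>v. ext (\<lambda>u. g u v) y) x + 1 * hat y x) x"
      by (simp add: green_def[abs_def])
    also have "\<dots> = flux (ext (\<lambda>v. ext (\<lambda>u. g u v) y)) x + flux (hat y) x"
      by (subst flux_lincomb[OF _ pw_poly_ext pw_poly_hat[OF y]]) auto
    also have "\<dots> = of_bool (x = y) - of_bool (x = Vert z)"
    proof (cases x)
      case (Vert v)
      with x have v: "v \<in> V" by simp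
      have "ext (\<lambda>u. vlap (g u) v) y = ext (\<lambda>u. of_bool (u = v) - of_bool (v = z)) y"
        using y by (rule ext_cong) (auto simp: g v)
      \<comment> \<open>Interpolation weights add up to 1, so the sink term, constant in
        \<open>u\<close>, passes through unchanged.\<close>
      also have "\<dots> = ext (\<lambda>u. of_bool (u = v)) y - of_bool (v = z)"
        by (cases y) (simp_all add: ext_def)
      finally show ?thesis
        using x y by (simp add: flux_ext flux_hat vlap_ext Vert)
    next
      case (Inner e t)
      then show ?thesis using x y by (simp add: flux_ext flux_hat)
    qed
    finally show "flux (green g y) x = of_bool (x = y) - of_bool (x = Vert z)" .
  qed
qed

text \<open>In \<open>G y - G z\<close> the common sink cancels, and the constant grounds the result
  at \<open>z\<close>. The other claims control \<open>G\<close> in either slot and on the diagonal,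
  all of which occur in \<open>jf \<Gamma> x p q\<close> as a function of \<open>x\<close>.\<close>

lemma potentials_exist:
  obtains G where
    "\<forall>y\<in>pts. \<forall>z\<in>pts. is_potential \<Gamma> y z (\<lambda>x. G y x - G z x - (G y z - G z z))"
    "\<forall>y\<in>pts. pw_poly {y} 1 (G y)" "\<forall>x\<in>pts. pw_poly {x} 1 (\<lambda>y. G y x)"
    "\<forall>S. pw_poly S 2 (\<lambda>x. G x x)"
proof -
  obtain z0 g where g: "\<forall>x\<in>pts. \<forall>y\<in>pts. flux (green g y) x = of_bool (x = y) - of_bool (x = z0)"
    using green_exists .
  have pot: "is_potential \<Gamma> y z (\<lambda>x. green g y x - green g z x - (green g y z - green g z z))"
    if y: "y \<in> pts" and z: "z \<in> pts" for y z
  proof -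
    let ?c = "green g y z - green g z z"
    have pw: "pw_poly {y, z} 1 (green g y)" "pw_poly {y, z} 1 (green g z)"
      using pw_poly_mono[OF pw_poly_green[OF y]] pw_poly_mono[OF pw_poly_green[OF z]] by auto
    note pw_diff = pw_poly_lincomb[OF pw, of 1 "- 1"]
    have eq: "(\<lambda>x. green g y x - green g z x - ?c) =
        (\<lambda>x. 1 * (1 * green g y x + - 1 * green g z x) + - ?c * 1)"
      by (simp add: fun_eq_iff)
    have "flux (\<lambda>x. green g y x - green g z x - ?c) x = of_bool (x = y) - of_bool (x = z)"
      if "x \<in> pts" for x
      using that g y z unfolding eq
      by (subst flux_lincomb[OF _ pw_diff pw_poly_const], simp, subst flux_lincomb[OF _ pw])
        (simp_all add: flux_const)
    moreover have "pw_poly {y, z} 1 (\<lambda>x. green g y x - green g z x - ?c)"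
      by (intro pw_poly_diff pw pw_poly_const)
    ultimately show ?thesis
      unfolding is_potential_iff by simp
  qed
  show ?thesis
    by (rule that[of "green g"])
      (intro ballI allI pot pw_poly_green pw_poly_green_left pw_poly_green_diagonal; assumption)+
qed

subsection \<open>The constant \<open>A_{p,q}\<close>\<close>

lemma ddx_eqI:
  assumes "Inner e t \<in> pts" "((\<lambda>s. f (ept e s)) has_real_derivative D) (at t)"
  shows "dx f (Inner e t) = D"
  using DERIV_imp_deriv[OF assms(2)] by (simp add: ddx_def)

lemma ddx_mult:
  assumes "finite S" "pw_poly S n f" "pw_poly S m g" "Inner e t \<in> pts - S"
  shows "dx (\<lambda>x. f x * g x) (Inner e t) =
    dx f (Inner e t) * g (Inner e t) + f (Inner e t) * dx g (Inner e t)"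
proof (rule ddx_eqI)
  have "ept e t = Inner e t" using assms(4) by (simp add: ept_inner)
  then show "((\<lambda>s. f (ept e s) * g (ept e s)) has_real_derivative
      dx f (Inner e t) * g (Inner e t) + f (Inner e t) * dx g (Inner e t)) (at t)"
    using DERIV_mult[OF has_ddx[OF assms(1) pw_poly_imp_inner[OF assms(2)] assms(4)]
        has_ddx[OF assms(1) pw_poly_imp_inner[OF assms(3)] assms(4)]]
    by (simp add: algebra_simps)
qed (use assms in simp)

lemma ddx_const_diff:
  assumes "finite S" "pw_poly S n f" "Inner e t \<in> pts - S" "\<And>x. x \<in> pts \<Longrightarrow> h x = c - f x"
  shows "dx h (Inner e t) = - dx f (Inner e t)"
proof (rule ddx_eqI)
  have "((\<lambda>s. c - f (ept e s)) has_real_derivative - dx f (Inner e t)) (at t)"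
    using DERIV_diff[OF DERIV_const has_ddx[OF assms(1) pw_poly_imp_inner[OF assms(2)] assms(3)]]
    by simp
  then show "((\<lambda>s. h (ept e s)) has_real_derivative - dx f (Inner e t)) (at t)"
    by (rule has_field_derivative_transform_within_open[of _ _ _ "{0<..<L e}"])
      (use assms(3,4) ept_in_pts[of e] in auto)
qed (use assms in simp)

text \<open>The Laplacian of \<open>J\<close> consists of the masses 1 at \<open>q\<close> and -1 at
  \<open>p\<close>, so Green's identity evaluates \<open>g\<close> at these two points.\<close>

lemma potential_pairing:
  assumes J: "is_potential \<Gamma> q p J" and pq: "p \<in> pts" "q \<in> pts" and g: "pw_poly {p, q} n g"
  shows "Int_dx (\<lambda>x. dx J x * dx g x) = g q - g p"
proof -
  have pw: "pw_poly {p, q} 1 J"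
    using J by (simp add: is_potential_iff insert_commute)
  have fl: "(\<Sum>d\<in>dirs x. dird J d) = of_bool (x = p) - of_bool (x = q)" if "x \<in> pts" for x
    using J that unfolding is_potential_iff flux_def sum_negf by force
  have "Int_dx (\<lambda>x. dx J x * dx g x) = integral_sm \<Gamma> g (laplacian \<Gamma> J)"
    using Green_identity[OF _ _ pw g] pq by simp
  also have "\<dots> = (\<Sum>x | x \<in> pts \<and> (\<Sum>d\<in>dirs x. dird J d) \<noteq> 0. g x * - (\<Sum>d\<in>dirs x. dird J d))"
    by (rule integral_laplacian_affine[OF _ pw]) simp
  also have "\<dots> = (\<Sum>x\<in>{p, q}. g x * (of_bool (x = q) - of_bool (x = p)))"
    by (rule sum.mono_neutral_cong_left) (use fl pq in \<open>auto split: if_splits\<close>)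
  \<comment> \<open>For \<open>p = q\<close> the two masses cancel and both sides are 0.\<close>
  also have "\<dots> = g q - g p"
    by (cases "p = q") auto
  finally show ?thesis .
qed

theorem A_const_identities:
  assumes p: "p \<in> pts" and q: "q \<in> pts"
  defines "J \<equiv> \<lambda>x. jf \<Gamma> p x q" and "H \<equiv> \<lambda>x. jf \<Gamma> q x p" and "K \<equiv> \<lambda>x. jf \<Gamma> x p q"
  shows "A_const \<Gamma> p q = 1 / 2 * integral_sm \<Gamma> K (laplacian \<Gamma> (\<lambda>x. J x * H x))"
    and "A_const \<Gamma> p q = 1 / 2 * integral_sm \<Gamma> (\<lambda>x. J x * H x) (laplacian \<Gamma> K)"
    and "A_const \<Gamma> p q = - Int_dx (\<lambda>x. J x * dx J x * dx K x)"
    and "A_const \<Gamma> p q = Int_dx (\<lambda>x. H x * dx J x * dx K x)"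
    and "A_const \<Gamma> p q = - ((resistance \<Gamma> p q)\<^sup>2 / 2) + Int_dx (\<lambda>x. resistance \<Gamma> p x * (dx J x)\<^sup>2)"
proof -
  obtain G where
    pot: "\<forall>y\<in>pts. \<forall>z\<in>pts. is_potential \<Gamma> y z (\<lambda>x. G y x - G z x - (G y z - G z z))"
    and G: "\<forall>y\<in>pts. pw_poly {y} 1 (G y)" "\<forall>x\<in>pts. pw_poly {x} 1 (\<lambda>y. G y x)"
      "\<forall>S. pw_poly S 2 (\<lambda>x. G x x)"
    using potentials_exist .
  have j: "jf \<Gamma> z x y = G y x - G z x - (G y z - G z z)" if "x \<in> pts" "y \<in> pts" "z \<in> pts" for x y z
    by (rule jf_eq[OF pot[rule_format]]) (use that in auto)
  define S where "S = {p, q}"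
  define r where "r = resistance \<Gamma> p q"
  define R where "R = resistance \<Gamma> p"
  have S: "finite S" "S \<subseteq> pts" by (auto simp: S_def p q)
  have J: "is_potential \<Gamma> q p J"
    by (rule is_potential_cong[OF _ p pot[rule_format, OF q p]]) (simp add: J_def j p q)
  have pwJ: "pw_poly S 1 J"
    using J by (simp add: is_potential_iff S_def insert_commute)
  have r: "r = J q" by (simp add: r_def J_def resistance_def)
  \<comment> \<open>Superposition: after expanding every potential in \<open>G\<close> the two sides
    agree term by term. The same works for \<open>H\<close>.\<close>
  have R: "R x = K x + J x" if "x \<in> pts" for x
    using that by (simp add: R_def resistance_def K_def J_def j p q)
  have H: "H x = r - J x" if "x \<in> pts" for x
    using that by (simp add: r H_def J_def j p q)
  have ends: "J p = 0" "K p = 0" "K q = 0"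
    by (simp_all add: J_def K_def j p q)
  \<comment> \<open>In \<open>K\<close> the variable occurs as source, as position and on the
    diagonal of \<open>G\<close>; the diagonal term raises the degree to 2.\<close>
  have pwK: "pw_poly S 2 K"
  proof (rule pw_poly_cong)
    show "pw_poly S 2 (\<lambda>x. G q p - G x p - (G q x - G x x))"
      using p q by (intro pw_poly_diff pw_poly_const pw_poly_mono[OF G(1)[rule_format, OF q]]
          pw_poly_mono[OF G(2)[rule_format, OF p]] G(3)[rule_format]) (auto simp: S_def)
  qed (simp add: K_def j p q)
  have pwH: "pw_poly S 1 H"
    by (rule pw_poly_cong[OF _ pw_poly_diff[OF pw_poly_const pwJ]]) (simp add: H)
  have dH: "dx H (Inner e t) = - dx J (Inner e t)" if "Inner e t \<in> pts - S" for e t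
    by (rule ddx_const_diff[OF S(1) pwJ that H])
  note inner = pw_poly_inner_mult pw_poly_inner_ddx pw_poly_imp_inner[OF pwJ]
    pw_poly_imp_inner[OF pwH] pw_poly_imp_inner[OF pwK]
  let ?A = "Int_dx (\<lambda>x. K x * (dx J x)\<^sup>2)"
  let ?B = "Int_dx (\<lambda>x. J x * dx J x * dx K x)"
  let ?C = "Int_dx (\<lambda>x. H x * dx J x * dx K x)"
  have A: "A_const \<Gamma> p q = ?A"
    by (simp add: A_const_def J_def K_def)
  have JK: "Int_dx (\<lambda>x. dx J x * dx K x) = 0"
    using potential_pairing[OF J p q pwK[unfolded S_def]] by (simp add: ends)
  \<comment> \<open>The sum is the pairing of \<open>J\<close> with \<open>J * K\<close>, which
    vanishes at both \<open>p\<close> and \<open>q\<close>.\<close>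
  have "?A + ?B = Int_dx (\<lambda>x. 1 * (K x * (dx J x)\<^sup>2) + 1 * (J x * dx J x * dx K x))"
    unfolding power2_eq_square by (subst Int_dx_lincomb[OF S(1)]) (intro inner | simp)+
  also have "\<dots> = Int_dx (\<lambda>x. dx J x * dx (\<lambda>x. J x * K x) x)"
    by (rule Int_dx_cong[OF S(1)])
      (subst ddx_mult[OF S(1) pwJ pwK], assumption, simp add: power2_eq_square algebra_simps)
  also have "\<dots> = 0"
    using potential_pairing[OF J p q pw_poly_mult[OF pwJ pwK, unfolded S_def]] by (simp add: ends)
  finally have AB: "?A = - ?B" by simp
  \<comment> \<open>Substituting \<open>H = r - J\<close> leaves \<open>- ?B\<close> and a multiple
    of the vanishing pairing of \<open>J\<close> with \<open>K\<close>.\<close>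
  have "?C = Int_dx (\<lambda>x. r * (dx J x * dx K x) + (- 1) * (J x * dx J x * dx K x))"
    by (rule Int_dx_cong[OF S(1)]) (simp add: H algebra_simps)
  also have "\<dots> = r * Int_dx (\<lambda>x. dx J x * dx K x) + (- 1) * ?B"
    by (rule Int_dx_lincomb[OF S(1)]) (intro inner)+
  finally have AC: "?A = ?C" using JK AB by simp
  \<comment> \<open>As \<open>H' = - J'\<close>, the product rule gives
    \<open>(J H)' = H J' - J J'\<close>. By Green's identity this one integral settles both
    Laplacian formulas.\<close>
  have "Int_dx (\<lambda>x. dx (\<lambda>x. J x * H x) x * dx K x) =
      Int_dx (\<lambda>x. 1 * (H x * dx J x * dx K x) + (- 1) * (J x * dx J x * dx K x))"
    by (rule Int_dx_cong[OF S(1)]) (subst ddx_mult[OF S(1) pwJ pwH], assumption, simp add: dH algebra_simps)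
  also have "\<dots> = 1 * ?C + (- 1) * ?B"
    by (rule Int_dx_lincomb[OF S(1)]) (intro inner)+
  finally have D: "Int_dx (\<lambda>x. dx (\<lambda>x. J x * H x) x * dx K x) = 2 * ?A"
    using AB AC by simp
  \<comment> \<open>The pairing of \<open>J\<close> with its square, whose values at
    \<open>p\<close> and \<open>q\<close> are 0 and the square of \<open>r\<close>.\<close>
  have JJ: "2 * Int_dx (\<lambda>x. J x * (dx J x)\<^sup>2) = r\<^sup>2"
  proof -
    have "2 * Int_dx (\<lambda>x. J x * (dx J x)\<^sup>2) =
        Int_dx (\<lambda>x. 2 * (J x * (dx J x)\<^sup>2) + 0 * J x)"
      unfolding power2_eq_square by (subst Int_dx_lincomb[OF S(1)]) (intro inner | simp)+
    also have "\<dots> = Int_dx (\<lambda>x. dx J x * dx (\<lambda>x. J x * J x) x)"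
      by (rule Int_dx_cong[OF S(1)])
        (subst ddx_mult[OF S(1) pwJ pwJ], assumption, simp add: power2_eq_square algebra_simps)
    also have "\<dots> = r\<^sup>2"
      using potential_pairing[OF J p q pw_poly_mult[OF pwJ pwJ, unfolded S_def]]
      by (simp add: ends r power2_eq_square)
    finally show ?thesis .
  qed
  \<comment> \<open>Splitting \<open>R = K + J\<close> separates \<open>?A\<close> from the integral
    just computed, which accounts for half the square of \<open>r\<close>.\<close>
  have "Int_dx (\<lambda>x. R x * (dx J x)\<^sup>2) = Int_dx (\<lambda>x. 1 * (K x * (dx J x)\<^sup>2) + 1 * (J x * (dx J x)\<^sup>2))"
    by (rule Int_dx_cong[OF S(1)]) (simp add: R algebra_simps)
  also have "\<dots> = ?A + Int_dx (\<lambda>x. J x * (dx J x)\<^sup>2)"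
    unfolding power2_eq_square by (subst Int_dx_lincomb[OF S(1)]) (intro inner | simp)+
  finally show "A_const \<Gamma> p q = - ((resistance \<Gamma> p q)\<^sup>2 / 2) + Int_dx (\<lambda>x. resistance \<Gamma> p x * (dx J x)\<^sup>2)"
    using JJ by (simp add: A R_def r_def)
  show "A_const \<Gamma> p q = 1 / 2 * integral_sm \<Gamma> K (laplacian \<Gamma> (\<lambda>x. J x * H x))"
    using D by (simp add: A Green_identity[OF S pw_poly_mult[OF pwJ pwH] pwK])
  show "A_const \<Gamma> p q = 1 / 2 * integral_sm \<Gamma> (\<lambda>x. J x * H x) (laplacian \<Gamma> K)"
    unfolding Green_identity[OF S pwK pw_poly_mult[OF pwJ pwH]]
    using D by (simp add: A mult.commute[of "dx K _"])
  show "A_const \<Gamma> p q = - ?B" "A_const \<Gamma> p q = ?C"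
    using A AB AC by simp_all
qed

end

theorem theorem4p4:
  fixes \<Gamma> :: "('v, 'e) mgraph" and p q :: "('v, 'e) pt"
  assumes "metrized_graph \<Gamma>" and "p \<in> points \<Gamma>" and "q \<in> points \<Gamma>"
  shows "A_const \<Gamma> p q =
           1 / 2 * integral_sm \<Gamma> (\<lambda>x. jf \<Gamma> x p q) (laplacian \<Gamma> (\<lambda>x. jf \<Gamma> p x q * jf \<Gamma> q x p))
    \<and> A_const \<Gamma> p q =
           1 / 2 * integral_sm \<Gamma> (\<lambda>x. jf \<Gamma> p x q * jf \<Gamma> q x p) (laplacian \<Gamma> (\<lambda>x. jf \<Gamma> x p q))
    \<and> A_const \<Gamma> p q =
           - integral_dx \<Gamma> (\<lambda>x. jf \<Gamma> p x q *
               ddx \<Gamma> (\<lambda>x. jf \<Gamma> p x q) x * ddx \<Gamma> (\<lambda>x. jf \<Gamma> x p q) x)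
    \<and> A_const \<Gamma> p q =
           integral_dx \<Gamma> (\<lambda>x. jf \<Gamma> q x p *
               ddx \<Gamma> (\<lambda>x. jf \<Gamma> p x q) x * ddx \<Gamma> (\<lambda>x. jf \<Gamma> x p q) x)
    \<and> A_const \<Gamma> p q =
           - ((resistance \<Gamma> p q)\<^sup>2 / 2) +
           integral_dx \<Gamma> (\<lambda>x. resistance \<Gamma> p x * (ddx \<Gamma> (\<lambda>x. jf \<Gamma> p x q) x)\<^sup>2)"
proof -
  interpret metrized \<Gamma> by unfold_locales (fact assms(1))
  show ?thesis
    using A_const_identities[OF assms(2,3)] by blast
qed

end
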